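(* Let $\mathbf{k}$ be a field of characteristic $0$ and let $\mathbb{P} = \mathrm{Proj}(B)$ where $B$ is an $\mathbb{N}$-graded normal affine $\mathbf{k}$-domain such that $\mathrm{ht}(B_+) \ge 2$. Let $F$ be a homogeneous prime element of $B$ of degree $d>0$ and let $X = \mathbb{V}_+(F) \subset \mathbb{P}$. If the affine variety $\mathbb{P} \setminus X$ has a non-trivial $G_a$-action then $(B/FB)^{(d)}$ is non-rigid.
   Context: Rings are commutative, associative and unital; "domain" means integral domain; normal means integrally closed in the field of fractions; an affine $\mathbf{k}$-domain is a domain that is a finitely generated $\mathbf{k}$-algebra. $\mathbb{N}$ contains $0$. For an $\mathbb{N}$-graded ring $B=\bigoplus_{n\in\mathbb{N}}B_n$, $B_+=\bigoplus_{n>0}B_n$. For homogeneous $F$ of positive degree, $\mathbb{V}_+(F)=\{\mathfrak{p}\in\mathrm{Proj}(B): F\in\mathfrak{p}\}$. Its complement is $\mathrm{Spec}(B_{(F)})$, where $B_{(F)}$ is the degree-$0$ subring of the graded localization $B_F$; a non-trivial $G_a$-action on $\mathrm{Spec}$ of an affine $\mathbf{k}$-domain $R$ exists if and only if $R$ has a nonzero locally nilpotent derivation. For a graded ring $A=\bigoplus_{i}A_i$ and $d\ge1$, $A^{(d)}=\bigoplus_{i\in d\mathbb{Z}}A_i$. A derivation $D:R\to R$ is locally nilpotent if for each $b\in R$ there is $n>0$ with $D^n(b)=0$. A ring is rigid if its only locally nilpotent derivation is $0$, and non-rigid otherwise. *)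

theory Defs
  imports "HOL-Algebra.Module" "HOL-Algebra.UnivPoly" "HOL-Algebra.QuotRing"
    "HOL-Algebra.Generated_Rings" "HOL-Algebra.Ring_Divisibility" "HOL-Library.Extended_Nat"
begin

section \<open>Localizations\<close>

definition local_frac :: "('a, 'm) ring_scheme \<Rightarrow> 'a set \<Rightarrow> 'a \<Rightarrow> 'a \<Rightarrow> ('a \<times> 'a) set" where
  "local_frac R S a s = {(b, t). b \<in> carrier R \<and> t \<in> S \<and>
     (\<exists>u\<in>S. u \<otimes>\<^bsub>R\<^esub> (a \<otimes>\<^bsub>R\<^esub> t) = u \<otimes>\<^bsub>R\<^esub> (b \<otimes>\<^bsub>R\<^esub> s))}"

text \<open>The localization of \<open>R\<close> at a multiplicative set \<open>S\<close>. The unions in the operations run over all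
  representatives of the two classes; all members of the union coincide.\<close>

definition localization :: "('a, 'm) ring_scheme \<Rightarrow> 'a set \<Rightarrow> ('a \<times> 'a) set ring" where
  "localization R S =
    \<lparr>carrier = {local_frac R S a s | a s. a \<in> carrier R \<and> s \<in> S},
     monoid.mult = (\<lambda>Z W. \<Union>(a, s)\<in>Z. \<Union>(b, t)\<in>W. local_frac R S (a \<otimes>\<^bsub>R\<^esub> b) (s \<otimes>\<^bsub>R\<^esub> t)),
     one = local_frac R S \<one>\<^bsub>R\<^esub> \<one>\<^bsub>R\<^esub>,
     ring.zero = local_frac R S \<zero>\<^bsub>R\<^esub> \<one>\<^bsub>R\<^esub>,
     add = (\<lambda>Z W. \<Union>(a, s)\<in>Z. \<Union>(b, t)\<in>W.
              local_frac R S ((a \<otimes>\<^bsub>R\<^esub> t) \<oplus>\<^bsub>R\<^esub> (b \<otimes>\<^bsub>R\<^esub> s)) (s \<otimes>\<^bsub>R\<^esub> t))\<rparr>"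

definition nonzeros :: "('a, 'm) ring_scheme \<Rightarrow> 'a set" where
  "nonzeros R = carrier R - {\<zero>\<^bsub>R\<^esub>}"

definition fraction_field :: "('a, 'm) ring_scheme \<Rightarrow> ('a \<times> 'a) set ring" where
  "fraction_field R = localization R (nonzeros R)"

definition to_fraction_field :: "('a, 'm) ring_scheme \<Rightarrow> 'a \<Rightarrow> ('a \<times> 'a) set" where
  "to_fraction_field R a = local_frac R (nonzeros R) a \<one>\<^bsub>R\<^esub>"

section \<open>Normal affine domains over a field\<close>

definition integral_elem ::
    "('a, 'm) ring_scheme \<Rightarrow> ('b, 'n) ring_scheme \<Rightarrow> ('a \<Rightarrow> 'b) \<Rightarrow> 'b \<Rightarrow> bool" where
  "integral_elem R S \<phi> x \<longleftrightarrow>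
     (\<exists>p \<in> carrier (UP R). coeff (UP R) p (deg R p) = \<one>\<^bsub>R\<^esub> \<and> eval R S \<phi> x p = \<zero>\<^bsub>S\<^esub>)"

definition normal_domain :: "('a, 'm) ring_scheme \<Rightarrow> bool" where
  "normal_domain R \<longleftrightarrow> domain R \<and>
     (\<forall>x \<in> carrier (fraction_field R).
        integral_elem R (fraction_field R) (to_fraction_field R) x \<longrightarrow>
        x \<in> to_fraction_field R ` carrier R)"

definition char_zero :: "('a, 'm) ring_scheme \<Rightarrow> bool" where
  "char_zero R \<longleftrightarrow> (\<forall>n::nat. n > 0 \<longrightarrow> [n] \<cdot>\<^bsub>R\<^esub> \<one>\<^bsub>R\<^esub> \<noteq> \<zero>\<^bsub>R\<^esub>)"

definition finitely_generated_algebra ::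
    "('k, 'm) ring_scheme \<Rightarrow> ('k, 'a, 'n) module_scheme \<Rightarrow> bool" where
  "finitely_generated_algebra k R \<longleftrightarrow> algebra k R \<and>
     (\<exists>G. finite G \<and> G \<subseteq> carrier R \<and>
        carrier R = generate_ring R ((\<lambda>c. c \<odot>\<^bsub>R\<^esub> \<one>\<^bsub>R\<^esub>) ` carrier k \<union> G))"

section \<open>Height\<close>

definition prime_height :: "('a, 'm) ring_scheme \<Rightarrow> 'a set \<Rightarrow> enat" where
  "prime_height R P =
     Sup {enat n | n. \<exists>Q :: nat \<Rightarrow> 'a set.
            (\<forall>i\<le>n. primeideal (Q i) R) \<and> (\<forall>i<n. Q i \<subset> Q (Suc i)) \<and> Q n = P}"

definition height :: "('a, 'm) ring_scheme \<Rightarrow> 'a set \<Rightarrow> enat" where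
  "height R I = Inf {prime_height R P | P. primeideal P R \<and> I \<subseteq> P}"

section \<open>Graded rings\<close>

definition nat_graded :: "('a, 'm) ring_scheme \<Rightarrow> (nat \<Rightarrow> 'a set) \<Rightarrow> bool" where
  "nat_graded R gr \<longleftrightarrow>
     (\<forall>n. additive_subgroup (gr n) R) \<and>
     (\<forall>m n. \<forall>a \<in> gr m. \<forall>b \<in> gr n. a \<otimes>\<^bsub>R\<^esub> b \<in> gr (m + n)) \<and>
     (\<forall>x \<in> carrier R. \<exists>!f. (\<forall>n. f n \<in> gr n) \<and> finite {n. f n \<noteq> \<zero>\<^bsub>R\<^esub>} \<and>
        x = (\<Oplus>\<^bsub>R\<^esub> n \<in> {n. f n \<noteq> \<zero>\<^bsub>R\<^esub>}. f n))"

text \<open>The sum of the pieces \<open>gr n\<close> with \<open>n \<in> N\<close>.\<close>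

definition graded_part :: "('a, 'm) ring_scheme \<Rightarrow> (nat \<Rightarrow> 'a set) \<Rightarrow> nat set \<Rightarrow> 'a set" where
  "graded_part R gr N =
     {\<Oplus>\<^bsub>R\<^esub> n \<in> I. f n | f I. finite I \<and> I \<subseteq> N \<and> (\<forall>n \<in> I. f n \<in> gr n)}"

definition irrelevant_ideal :: "('a, 'm) ring_scheme \<Rightarrow> (nat \<Rightarrow> 'a set) \<Rightarrow> 'a set" where
  "irrelevant_ideal R gr = graded_part R gr {n. n > 0}"

definition veronese ::
    "('a, 'm) ring_scheme \<Rightarrow> (nat \<Rightarrow> 'a set) \<Rightarrow> nat \<Rightarrow> ('a, 'm) ring_scheme" where
  "veronese R gr d = R\<lparr>carrier := graded_part R gr {n. d dvd n}\<rparr>"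

definition quotient_grading ::
    "('a, 'm) ring_scheme \<Rightarrow> (nat \<Rightarrow> 'a set) \<Rightarrow> 'a set \<Rightarrow> nat \<Rightarrow> 'a set set" where
  "quotient_grading R gr I n = (\<lambda>x. I +>\<^bsub>R\<^esub> x) ` gr n"

definition homogeneous_ideal ::
    "('a, 'm) ring_scheme \<Rightarrow> (nat \<Rightarrow> 'a set) \<Rightarrow> 'a set \<Rightarrow> bool" where
  "homogeneous_ideal R gr I \<longleftrightarrow> ideal I R \<and> I = Idl\<^bsub>R\<^esub> (I \<inter> (\<Union>n. gr n))"

section \<open>Proj and its structure sheaf\<close>

definition Proj :: "('a, 'm) ring_scheme \<Rightarrow> (nat \<Rightarrow> 'a set) \<Rightarrow> 'a set set" where
  "Proj R gr = {p. primeideal p R \<and> homogeneous_ideal R gr p \<and> \<not> irrelevant_ideal R gr \<subseteq> p}"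

definition V_plus :: "('a, 'm) ring_scheme \<Rightarrow> (nat \<Rightarrow> 'a set) \<Rightarrow> 'a \<Rightarrow> 'a set set" where
  "V_plus R gr f = {p \<in> Proj R gr. f \<in> p}"

definition Proj_open :: "('a, 'm) ring_scheme \<Rightarrow> (nat \<Rightarrow> 'a set) \<Rightarrow> 'a set set \<Rightarrow> bool" where
  "Proj_open R gr V \<longleftrightarrow>
     (\<exists>I. homogeneous_ideal R gr I \<and> V = {p \<in> Proj R gr. \<not> I \<subseteq> p})"

definition homogeneous_off :: "(nat \<Rightarrow> 'a set) \<Rightarrow> 'a set \<Rightarrow> 'a set" where
  "homogeneous_off gr p = (\<Union>n. gr n) - p"

text \<open>The stalk of the structure sheaf at \<open>p\<close>: the degree-zero part of the localization of \<open>R\<close> at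
  the homogeneous elements outside \<open>p\<close>.\<close>

definition homogeneous_localization ::
    "('a, 'm) ring_scheme \<Rightarrow> (nat \<Rightarrow> 'a set) \<Rightarrow> 'a set \<Rightarrow> ('a \<times> 'a) set ring" where
  "homogeneous_localization R gr p =
     (localization R (homogeneous_off gr p))
       \<lparr>carrier := {local_frac R (homogeneous_off gr p) a s | a s n. a \<in> gr n \<and> s \<in> gr n \<and> s \<notin> p}\<rparr>"

text \<open>The \<open>k\<close>-algebra of regular functions on an open set \<open>U\<close> of \<open>Proj R\<close>: the functions assigning
  to each \<open>p \<in> U\<close> an element of the stalk at \<open>p\<close> that are locally quotients of homogeneous elements
  of the same degree. They are extensional, i.e. \<open>undefined\<close> off \<open>U\<close>.

  A field \<open>k\<close> acts on them, for \<open>R\<close> a domain, because \<open>c \<odot> \<one>\<close> is zero or a unit, and the units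
  of an \<open>\<nat>\<close>-graded domain have degree zero; hence a separate assumption that \<open>k\<close> acts by
  degree-zero elements is not needed.\<close>

definition regular_functions ::
    "('k, 'a, 'm) module_scheme \<Rightarrow> (nat \<Rightarrow> 'a set) \<Rightarrow> 'a set set \<Rightarrow>
       ('k, 'a set \<Rightarrow> ('a \<times> 'a) set) module" where
  "regular_functions R gr U =
    \<lparr>carrier = {\<sigma> \<in> (\<Pi>\<^sub>E p\<in>U. carrier (homogeneous_localization R gr p)).
        \<forall>p \<in> U. \<exists>V. Proj_open R gr V \<and> p \<in> V \<and> V \<subseteq> U \<and>
          (\<exists>n. \<exists>a \<in> gr n. \<exists>s \<in> gr n. \<forall>q \<in> V.
             s \<notin> q \<and> \<sigma> q = local_frac R (homogeneous_off gr q) a s)},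
     monoid.mult = (\<lambda>\<sigma> \<tau>. \<lambda>p\<in>U. \<sigma> p \<otimes>\<^bsub>homogeneous_localization R gr p\<^esub> \<tau> p),
     one = (\<lambda>p\<in>U. \<one>\<^bsub>homogeneous_localization R gr p\<^esub>),
     ring.zero = (\<lambda>p\<in>U. \<zero>\<^bsub>homogeneous_localization R gr p\<^esub>),
     add = (\<lambda>\<sigma> \<tau>. \<lambda>p\<in>U. \<sigma> p \<oplus>\<^bsub>homogeneous_localization R gr p\<^esub> \<tau> p),
     smult = (\<lambda>c \<sigma>. \<lambda>p\<in>U. local_frac R (homogeneous_off gr p) (c \<odot>\<^bsub>R\<^esub> \<one>\<^bsub>R\<^esub>) \<one>\<^bsub>R\<^esub>
                \<otimes>\<^bsub>homogeneous_localization R gr p\<^esub> \<sigma> p)\<rparr>"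

section \<open>Actions of the additive group on affine varieties\<close>

text \<open>An affine open set, such as the complement of \<open>V_plus R gr f\<close> for \<open>f\<close> homogeneous of positive
  degree, is the spectrum of its ring of regular functions.

  An action of the additive group \<open>Spec k[T]\<close> on the affine variety \<open>Spec A\<close> over \<open>k\<close> is a
  morphism \<open>Spec A[T] \<rightarrow> Spec A\<close>, i.e. a homomorphism \<open>\<rho>: A \<rightarrow> A[T]\<close> of \<open>k\<close>-algebras. The
  identity acts trivially: \<open>\<rho>\<close> followed by \<open>T \<mapsto> 0\<close> is the identity. Associativity: in
  \<open>A[T][T']\<close>, applying \<open>\<rho>\<close> to the coefficients of \<open>\<rho> a\<close> (and renaming \<open>T\<close> in \<open>\<rho> a\<close> to \<open>T'\<close>)
  agrees with substituting \<open>T + T'\<close> for \<open>T\<close> in \<open>\<rho> a\<close>.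
  An element of \<open>UP A\<close> is its sequence of coefficients, so in the last clause the left-hand side
  is the polynomial in \<open>T'\<close> with coefficients \<open>\<rho> (coeff (UP A) (\<rho> a) n)\<close>.\<close>

definition Ga_action ::
    "('k, 'm) ring_scheme \<Rightarrow> ('k, 'a, 'n) module_scheme \<Rightarrow> ('a \<Rightarrow> nat \<Rightarrow> 'a) \<Rightarrow> bool" where
  "Ga_action k A \<rho> \<longleftrightarrow>
     \<rho> \<in> ring_hom A (UP A) \<and>
     (\<forall>c \<in> carrier k. \<rho> (c \<odot>\<^bsub>A\<^esub> \<one>\<^bsub>A\<^esub>) = monom (UP A) (c \<odot>\<^bsub>A\<^esub> \<one>\<^bsub>A\<^esub>) 0) \<and>
     (\<forall>a \<in> carrier A. eval A A (\<lambda>x. x) \<zero>\<^bsub>A\<^esub> (\<rho> a) = a) \<and>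
     (\<forall>a \<in> carrier A.
        (\<lambda>n. \<rho> (coeff (UP A) (\<rho> a) n)) =
        eval A (UP (UP A)) (\<lambda>x. monom (UP (UP A)) (monom (UP A) x 0) 0)
          (monom (UP (UP A)) (monom (UP A) \<one>\<^bsub>A\<^esub> 1) 0
             \<oplus>\<^bsub>UP (UP A)\<^esub> monom (UP (UP A)) \<one>\<^bsub>UP A\<^esub> 1)
          (\<rho> a))"

text \<open>The trivial action is the projection, whose comorphism is the inclusion of constants.\<close>

definition has_nontrivial_Ga_action ::
    "('k, 'm) ring_scheme \<Rightarrow> ('k, 'a, 'n) module_scheme \<Rightarrow> bool" where
  "has_nontrivial_Ga_action k A \<longleftrightarrow>
     (\<exists>\<rho>. Ga_action k A \<rho> \<and> (\<exists>a \<in> carrier A. \<rho> a \<noteq> monom (UP A) a 0))"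

section \<open>Locally nilpotent derivations\<close>

definition derivation :: "('a, 'm) ring_scheme \<Rightarrow> ('a \<Rightarrow> 'a) \<Rightarrow> bool" where
  "derivation R D \<longleftrightarrow> D \<in> carrier R \<rightarrow> carrier R \<and>
     (\<forall>a \<in> carrier R. \<forall>b \<in> carrier R. D (a \<oplus>\<^bsub>R\<^esub> b) = D a \<oplus>\<^bsub>R\<^esub> D b) \<and>
     (\<forall>a \<in> carrier R. \<forall>b \<in> carrier R.
        D (a \<otimes>\<^bsub>R\<^esub> b) = (D a \<otimes>\<^bsub>R\<^esub> b) \<oplus>\<^bsub>R\<^esub> (a \<otimes>\<^bsub>R\<^esub> D b))"

definition locally_nilpotent_derivation :: "('a, 'm) ring_scheme \<Rightarrow> ('a \<Rightarrow> 'a) \<Rightarrow> bool" where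
  "locally_nilpotent_derivation R D \<longleftrightarrow>
     derivation R D \<and> (\<forall>b \<in> carrier R. \<exists>n>0. (D ^^ n) b = \<zero>\<^bsub>R\<^esub>)"

definition rigid :: "('a, 'm) ring_scheme \<Rightarrow> bool" where
  "rigid R \<longleftrightarrow>
     (\<forall>D. locally_nilpotent_derivation R D \<longrightarrow> (\<forall>a \<in> carrier R. D a = \<zero>\<^bsub>R\<^esub>))"

end

theory Submission
  imports Defs
begin

text \<open>The affine variety is \<open>Spec A\<close> with \<open>A = B\<^sub>(\<^sub>F\<^sub>)\<close>, and the action gives a nonzero \<open>k\<close>-linear locally
  nilpotent derivation \<open>D\<close> of \<open>A\<close>. Filter \<open>A\<close> by \<open>A\<^sub>n = {a / F\<^sup>n | a \<in> B\<^sub>n\<^sub>d}\<close>. Since \<open>B\<close> is finitely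
  generated, there is \<open>e\<close> with \<open>D A\<^sub>n \<subseteq> A\<^sub>n\<^sub>+\<^sub>e\<close> for all \<open>n\<close>. The Rees algebra \<open>\<Sum>\<^sub>n A\<^sub>n T\<^sup>n \<subseteq> A[T]\<close> of the
  filtration is isomorphic to the Veronese ring \<open>B\<^sup>(\<^sup>d\<^sup>)\<close>, with \<open>T\<close> corresponding to \<open>F\<close>, and is stable
  under \<open>T\<^sup>e D\<close>. This gives a nonzero locally nilpotent derivation of \<open>B\<^sup>(\<^sup>d\<^sup>)\<close> that kills \<open>F\<close>. Divide it
  by the largest power of \<open>F\<close> that divides all its values and reduce modulo \<open>F\<close>.\<close>

section \<open>Homogeneous components\<close>

text \<open>On A only a filtration remains of the grading of B, and F has become 1. The Rees algebra
  restores F as a parameter T: T = 1 gives A, and T = 0 gives B^(d) / F B^(d), which is (B/FB)^(d)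
  because F is homogeneous of degree d. The factor T^e compensates for D raising the filtration. One
  e serves all n because each term of the Leibniz rule differentiates a single factor, so a bound
  valid for finitely many elements passes to their products; the constants of k cost nothing, as D
  kills them. Generators of B may have degrees not divisible by d, which is why their d-th powers
  and finitely many remainder monomials take their place. Killing F makes the ideal F B^(d) stable,
  and dividing by a maximal power of F keeps the reduction nonzero; a maximum exists because F^m
  dividing one fixed nonzero value bounds m by degrees. Two facts come before all this: in
  characteristic 0 a nontrivial action has a nonzero linear coefficient, which is D; and regular
  functions, given as sections of a sheaf, must be recognised as fractions a / F^n.\<close>

lemma up_iff: "p \<in> up R \<longleftrightarrow> (\<forall>n. p n \<in> carrier R) \<and> finite {n. p n \<noteq> \<zero>\<^bsub>R\<^esub>}"
proof -
  have "(\<exists>n. bound \<zero>\<^bsub>R\<^esub> n p) \<longleftrightarrow> finite {n. p n \<noteq> \<zero>\<^bsub>R\<^esub>}"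
    unfolding finite_nat_set_iff_bounded_le bound_def by (auto simp: not_less[symmetric])
  then show ?thesis by (auto simp: up_def)
qed

lemma UP_carrier: "carrier (UP R) = up R"
  by (simp add: UP_def)

lemma coeff_UP: "p \<in> up R \<Longrightarrow> coeff (UP R) p = p"
  by (simp add: UP_def)

lemma UP_add: "p \<in> up R \<Longrightarrow> q \<in> up R \<Longrightarrow> (p \<oplus>\<^bsub>UP R\<^esub> q) n = p n \<oplus>\<^bsub>R\<^esub> q n"
  by (simp add: UP_def)

lemma UP_mult:
  "p \<in> up R \<Longrightarrow> q \<in> up R \<Longrightarrow> (p \<otimes>\<^bsub>UP R\<^esub> q) n = (\<Oplus>\<^bsub>R\<^esub>i\<in>{..n}. p i \<otimes>\<^bsub>R\<^esub> q (n - i))"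
  by (simp add: UP_def)

lemma UP_one: "\<one>\<^bsub>UP R\<^esub> n = (if n = 0 then \<one>\<^bsub>R\<^esub> else \<zero>\<^bsub>R\<^esub>)"
  by (simp add: UP_def)

lemma UP_zero: "\<zero>\<^bsub>UP R\<^esub> n = \<zero>\<^bsub>R\<^esub>"
  by (simp add: UP_def)

lemma UP_monom: "a \<in> carrier R \<Longrightarrow> monom (UP R) a m n = (if n = m then a else \<zero>\<^bsub>R\<^esub>)"
  by (simp add: UP_def)

section \<open>Polynomials over the ring as families of components, with summation as evaluation at
  1\<close>

context cring
begin

text \<open>A decomposition into homogeneous components is stored as a polynomial whose n-th
  coefficient has degree n. Summing the components is then evaluation at 1, a ring homomorphism, and
  this carries sums and products over to components.\<close>

abbreviation eval1 :: "(nat \<Rightarrow> 'a) \<Rightarrow> 'a"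
  where "eval1 \<equiv> eval R R (\<lambda>x. x) \<one>"

lemma UP_is_cring: "cring (UP R)"
  by (meson UP_cring.UP_cring UP_cring.intro cring_axioms)

lemma eval1_hom: "eval1 \<in> ring_hom (UP R) R"
proof -
  have "UP_pre_univ_prop R R (\<lambda>x. x)"
    by (rule UP_pre_univ_propI) (auto simp: cring_axioms ring_hom_def)
  then show ?thesis by (rule UP_pre_univ_prop.eval_ring_hom) simp
qed

lemma eval1_eq:
  assumes p: "p \<in> up R" and I: "finite I" "{n. p n \<noteq> \<zero>} \<subseteq> I"
  shows "eval1 p = (\<Oplus>n\<in>I. p n)"
proof -
  interpret U: UP_ring R "UP R"
    by (simp add: UP_ring_def ring_axioms)
  have pc: "p n \<in> carrier R" for n using p by (auto simp: up_iff)
  have sub: "{n. p n \<noteq> \<zero>} \<subseteq> {..deg R p}"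
    using U.deg_aboveD[of p] p by (force simp: UP_carrier coeff_UP not_less[symmetric])
  have "eval1 p = (\<Oplus>i\<in>{..deg R p}. p i)"
    using p by (auto simp: eval_def UP_carrier coeff_UP pc intro!: finsum_cong')
  also have "\<dots> = (\<Oplus>i\<in>{n. p n \<noteq> \<zero>}. p i)"
    by (rule add.finprod_mono_neutral_cong_right) (use sub pc in auto)
  also have "\<dots> = (\<Oplus>i\<in>I. p i)"
    by (rule add.finprod_mono_neutral_cong_left) (use I pc in auto)
  finally show ?thesis .
qed

end

locale graded_cring = cring R for R (structure) +
  fixes gr :: "nat \<Rightarrow> 'a set"
  assumes graded: "nat_graded R gr"
begin

text \<open>As a map into R[T] this is x \<mapsto> sum of x_n T^n, the coaction of the
  multiplicative group that belongs to the grading.\<close>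

definition hcomp :: "'a \<Rightarrow> nat \<Rightarrow> 'a" where
  "hcomp x = (THE f. f \<in> up R \<and> (\<forall>n. f n \<in> gr n) \<and> eval1 f = x)"

lemma gr_subgroup: "additive_subgroup (gr n) R"
  using graded by (simp add: nat_graded_def)

lemma gr_carrier: "a \<in> gr n \<Longrightarrow> a \<in> carrier R"
  by (rule additive_subgroup.a_Hcarr[OF gr_subgroup])

lemma gr_zero: "\<zero> \<in> gr n"
  by (rule additive_subgroup.zero_closed[OF gr_subgroup])

lemma gr_add: "a \<in> gr n \<Longrightarrow> b \<in> gr n \<Longrightarrow> a \<oplus> b \<in> gr n"
  by (rule additive_subgroup.a_closed[OF gr_subgroup])

lemma gr_minus: "a \<in> gr n \<Longrightarrow> \<ominus> a \<in> gr n"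
  using subgroup.m_inv_closed[OF additive_subgroup.a_subgroup[OF gr_subgroup]] by (simp add: a_inv_def)

lemma gr_mult: "a \<in> gr m \<Longrightarrow> b \<in> gr n \<Longrightarrow> a \<otimes> b \<in> gr (m + n)"
  using graded by (simp add: nat_graded_def)

lemma gr_finsum: "(\<And>i. i \<in> I \<Longrightarrow> f i \<in> gr n) \<Longrightarrow> (\<Oplus>i\<in>I. f i) \<in> gr n"
proof (induction I rule: infinite_finite_induct)
  case (insert i I)
  then have "f i \<in> carrier R" "f \<in> I \<rightarrow> carrier R" by (auto intro: gr_carrier)
  with insert show ?case by (simp add: finsum_insert gr_add)
qed (auto simp: gr_zero)

lemma ex1_components:
  assumes "x \<in> carrier R"
  shows "\<exists>!f. f \<in> up R \<and> (\<forall>n. f n \<in> gr n) \<and> eval1 f = x"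
proof -
  have "f \<in> up R \<and> (\<forall>n. f n \<in> gr n) \<and> eval1 f = x \<longleftrightarrow>
     (\<forall>n. f n \<in> gr n) \<and> finite {n. f n \<noteq> \<zero>} \<and> x = (\<Oplus>n\<in>{n. f n \<noteq> \<zero>}. f n)" for f
    using eval1_eq[of f "{n. f n \<noteq> \<zero>}"] unfolding up_iff by (metis gr_carrier order_refl)
  then show ?thesis using graded assms by (simp add: nat_graded_def)
qed

lemma
  assumes "x \<in> carrier R"
  shows hcomp_up: "hcomp x \<in> up R"
    and hcomp_gr: "hcomp x n \<in> gr n"
    and eval1_hcomp: "eval1 (hcomp x) = x"
  using theI'[OF ex1_components[OF assms]] by (auto simp: hcomp_def)

lemma hcomp_eqI:
  assumes "f \<in> up R" "\<And>n. f n \<in> gr n" "eval1 f = x"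
  shows "hcomp x = f"
proof -
  have "x \<in> carrier R"
    using assms(1,3) ring_hom_closed[OF eval1_hom] by (auto simp: UP_carrier)
  then show ?thesis
    unfolding hcomp_def using assms by (intro the1_equality ex1_components) auto
qed

lemma hcomp_carrier: "x \<in> carrier R \<Longrightarrow> hcomp x n \<in> carrier R"
  using hcomp_gr gr_carrier by blast

lemma hcomp_inj: "x \<in> carrier R \<Longrightarrow> y \<in> carrier R \<Longrightarrow> hcomp x = hcomp y \<Longrightarrow> x = y"
  by (metis eval1_hcomp)

lemma hcomp_add:
  assumes "x \<in> carrier R" "y \<in> carrier R"
  shows "hcomp (x \<oplus> y) n = hcomp x n \<oplus> hcomp y n"
proof -
  have "hcomp (x \<oplus> y) = hcomp x \<oplus>\<^bsub>UP R\<^esub> hcomp y"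
    using assms hcomp_up ring_hom_add[OF eval1_hom] cring.cring_simprules(1)[OF UP_is_cring]
    by (intro hcomp_eqI) (auto simp: UP_carrier UP_add gr_add hcomp_gr eval1_hcomp)
  then show ?thesis using assms by (simp add: UP_add hcomp_up)
qed

text \<open>By uniqueness of the decomposition: the product polynomial has its n-th coefficient in
  degree n and evaluates at 1 to \<open>x \<otimes> y\<close>.\<close>

lemma hcomp_mult_UP:
  assumes "x \<in> carrier R" "y \<in> carrier R"
  shows "hcomp (x \<otimes> y) = hcomp x \<otimes>\<^bsub>UP R\<^esub> hcomp y"
proof (rule hcomp_eqI)
  show "hcomp x \<otimes>\<^bsub>UP R\<^esub> hcomp y \<in> up R"
    using assms hcomp_up cring.cring_simprules(5)[OF UP_is_cring] by (auto simp: UP_carrier)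
  show "eval1 (hcomp x \<otimes>\<^bsub>UP R\<^esub> hcomp y) = x \<otimes> y"
    using assms hcomp_up ring_hom_mult[OF eval1_hom] by (auto simp: UP_carrier eval1_hcomp)
  fix n
  have "hcomp x i \<otimes> hcomp y (n - i) \<in> gr n" if "i \<le> n" for i
    using gr_mult[OF hcomp_gr hcomp_gr, OF assms, of i "n - i"] that by simp
  then show "(hcomp x \<otimes>\<^bsub>UP R\<^esub> hcomp y) n \<in> gr n"
    using assms by (auto simp: UP_mult hcomp_up intro!: gr_finsum)
qed

lemma hcomp_mult:
  assumes "x \<in> carrier R" "y \<in> carrier R"
  shows "hcomp (x \<otimes> y) n = (\<Oplus>i\<in>{..n}. hcomp x i \<otimes> hcomp y (n - i))"
  using assms by (simp add: hcomp_mult_UP UP_mult hcomp_up)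

lemma hcomp_homogeneous:
  assumes "a \<in> gr m"
  shows "hcomp a = (\<lambda>n. if n = m then a else \<zero>)"
proof (rule hcomp_eqI)
  have a: "a \<in> carrier R" using assms gr_carrier by blast
  show up: "(\<lambda>n. if n = m then a else \<zero>) \<in> up R"
    using a by (auto simp: up_iff)
  show "(if n = m then a else \<zero>) \<in> gr n" for n using assms by (auto simp: gr_zero)
  show "eval1 (\<lambda>n. if n = m then a else \<zero>) = a"
    using a by (subst eval1_eq[OF up, of "{m}"]) auto
qed

lemma hcomp_zero: "hcomp \<zero> n = \<zero>"
  by (simp add: hcomp_homogeneous[OF gr_zero[of 0]])

lemma hcomp_minus: "x \<in> carrier R \<Longrightarrow> hcomp (\<ominus> x) n = \<ominus> hcomp x n"
  by (metis a_inv_closed add.inv_equality hcomp_add hcomp_carrier hcomp_zero l_neg)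

lemma hcomp_mult_homogeneous:
  assumes a: "a \<in> gr m" and x: "x \<in> carrier R"
  shows "hcomp (a \<otimes> x) n = (if m \<le> n then a \<otimes> hcomp x (n - m) else \<zero>)"
proof -
  have ac: "a \<in> carrier R" using a gr_carrier by blast
  have "hcomp (a \<otimes> x) n = (\<Oplus>i\<in>{..n}. if m = i then a \<otimes> hcomp x (n - m) else \<zero>)"
    unfolding hcomp_mult[OF ac x] using ac x
    by (intro finsum_cong') (auto simp: hcomp_homogeneous[OF a] hcomp_carrier)
  then show ?thesis
    using ac x finsum_singleton[of m "{..n}" "\<lambda>_. a \<otimes> hcomp x (n - m)"]
    by (auto simp: hcomp_carrier intro!: add.finprod_one_eqI)
qed

lemma finite_hcomp: "x \<in> carrier R \<Longrightarrow> finite {n. hcomp x n \<noteq> \<zero>}"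
  using hcomp_up by (auto simp: up_iff)

lemma hcomp_sum:
  assumes "x \<in> carrier R"
  shows "x = (\<Oplus>n\<in>{n. hcomp x n \<noteq> \<zero>}. hcomp x n)"
  using eval1_eq[OF hcomp_up finite_hcomp] eval1_hcomp assms by (metis order_refl)

text \<open>\<open>nat_graded\<close> does not list this as an axiom. Comparing components of degree
  n in a = a 1 shows that the degree-zero component e of 1 fixes every homogeneous a; hence e = e 1
  and 1 have the same components.\<close>

lemma one_gr: "\<one> \<in> gr 0"
proof -
  define e where "e = hcomp \<one> 0"
  have e: "e \<in> gr 0" "e \<in> carrier R"
    by (simp_all add: e_def hcomp_gr hcomp_carrier)
  have e_hom: "e \<otimes> a = a" if a: "a \<in> gr n" for a n
  proof -
    have ac: "a \<in> carrier R" using a gr_carrier by blast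
    have "a = hcomp (a \<otimes> \<one>) n" using hcomp_homogeneous[OF a] ac by simp
    also have "\<dots> = a \<otimes> e" using hcomp_mult_homogeneous[OF a, of \<one> n] by (simp add: e_def)
    finally show ?thesis using ac e by (simp add: m_comm)
  qed
  have "hcomp (e \<otimes> \<one>) = hcomp \<one>"
    by (rule ext) (simp add: hcomp_mult_homogeneous[OF e(1)] e_hom[OF hcomp_gr])
  then show ?thesis using hcomp_inj[of e \<one>] e by simp
qed

lemma pow_gr: "a \<in> gr m \<Longrightarrow> a [^] (n::nat) \<in> gr (n * m)"
  by (induction n) (auto simp: one_gr add.commute dest: gr_mult)

end

text \<open>The component polynomials of u and v multiply to 1 in the polynomial ring over a domain.
  Degrees add there, so both polynomials are constant.\<close>

lemma unit_gr_0:
  assumes "domain R" "graded_cring R gr" "u \<in> carrier R" "v \<in> carrier R" "u \<otimes>\<^bsub>R\<^esub> v = \<one>\<^bsub>R\<^esub>"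
  shows "u \<in> gr 0"
proof -
  interpret graded_cring R gr by fact
  interpret domain R by fact
  interpret U: UP_domain R "UP R"
    by (simp add: UP_domain_def domain_axioms)
  have one: "hcomp \<one>\<^bsub>R\<^esub> = \<one>\<^bsub>UP R\<^esub>"
    by (rule ext) (simp add: hcomp_homogeneous[OF one_gr] UP_one)
  have mult: "hcomp u \<otimes>\<^bsub>UP R\<^esub> hcomp v = \<one>\<^bsub>UP R\<^esub>"
    using hcomp_mult_UP[of u v] assms(3-5) one by simp
  have c: "hcomp u \<in> carrier (UP R)" "hcomp v \<in> carrier (UP R)"
    using assms by (auto simp: UP_carrier hcomp_up)
  have "hcomp u \<noteq> \<zero>\<^bsub>UP R\<^esub>" "hcomp v \<noteq> \<zero>\<^bsub>UP R\<^esub>"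
    using mult c by auto
  then have "deg R (hcomp u) + deg R (hcomp v) = 0"
    using U.deg_mult c mult U.deg_one by metis
  then have "hcomp u n = \<zero>\<^bsub>R\<^esub>" if "n > 0" for n
    using U.deg_aboveD[of "hcomp u" n] c that by (simp add: coeff_UP UP_carrier)
  then have "eval1 (hcomp u) = hcomp u 0"
    using assms by (subst eval1_eq[of _ "{0}"]) (auto simp: hcomp_up hcomp_carrier)
  then show ?thesis using assms by (simp add: eval1_hcomp) (metis hcomp_gr)
qed

section \<open>Locally nilpotent derivations\<close>

lemma derivationD:
  assumes "derivation R D"
  shows "a \<in> carrier R \<Longrightarrow> D a \<in> carrier R"
    and "a \<in> carrier R \<Longrightarrow> b \<in> carrier R \<Longrightarrow> D (a \<oplus>\<^bsub>R\<^esub> b) = D a \<oplus>\<^bsub>R\<^esub> D b"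
    and "a \<in> carrier R \<Longrightarrow> b \<in> carrier R \<Longrightarrow>
      D (a \<otimes>\<^bsub>R\<^esub> b) = (D a \<otimes>\<^bsub>R\<^esub> b) \<oplus>\<^bsub>R\<^esub> (a \<otimes>\<^bsub>R\<^esub> D b)"
  using assms by (auto simp: derivation_def)

lemma derivation_funpow_closed:
  "derivation R D \<Longrightarrow> a \<in> carrier R \<Longrightarrow> (D ^^ n) a \<in> carrier R"
  by (induction n) (auto intro: derivationD(1))

lemma lnd_derivation: "locally_nilpotent_derivation R D \<Longrightarrow> derivation R D"
  by (simp add: locally_nilpotent_derivation_def)

context cring
begin

lemma derivation_zero: "derivation R D \<Longrightarrow> D \<zero> = \<zero>"
  by (metis derivationD(1,2) add.l_cancel_one' zero_closed l_zero)

lemma derivation_one: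
  assumes "derivation R D" shows "D \<one> = \<zero>"
proof -
  have "D \<one> = D \<one> \<oplus> D \<one>"
    using derivationD[OF assms] by (metis one_closed l_one r_one)
  then show ?thesis using derivationD(1)[OF assms, of \<one>] by simp
qed

lemma derivation_finsum:
  assumes "derivation R D" "f \<in> I \<rightarrow> carrier R"
  shows "D (\<Oplus>i\<in>I. f i) = (\<Oplus>i\<in>I. D (f i))"
  using assms(2)
proof (induction I rule: infinite_finite_induct)
  case (insert i I)
  moreover from this have "f i \<in> carrier R" "f \<in> I \<rightarrow> carrier R" by auto
  moreover from this have "(\<lambda>i. D (f i)) \<in> I \<rightarrow> carrier R"
    by (auto intro: derivationD(1)[OF assms(1)])
  ultimately show ?case using derivationD[OF assms(1)] by simp
qed (auto simp: derivation_zero[OF assms(1)])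

text \<open>The conclusion covers all large exponents, so that finitely many elements can share
  one.\<close>

lemma lnd_funpow_zero:
  assumes "locally_nilpotent_derivation R D" "x \<in> carrier R"
  obtains n where "\<And>m. m \<ge> n \<Longrightarrow> (D ^^ m) x = \<zero>"
proof -
  obtain n where n: "(D ^^ n) x = \<zero>"
    using assms by (auto simp: locally_nilpotent_derivation_def)
  have "(D ^^ j) \<zero> = \<zero>" for j
    by (induction j) (auto simp: derivation_zero[OF lnd_derivation[OF assms(1)]])
  then have "(D ^^ m) x = \<zero>" if "m \<ge> n" for m
    using n that funpow_add[of "m - n" n D] by simp
  then show thesis using that by blast
qed

text \<open>E kills every power of t, so the j-th iterate of t E is t^j E^j.\<close>

lemma lnd_scale:
  assumes E: "locally_nilpotent_derivation R E" and t: "t \<in> carrier R" "E t = \<zero>"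
  shows "locally_nilpotent_derivation R (\<lambda>x. t \<otimes> E x)"
  unfolding locally_nilpotent_derivation_def
proof (intro conjI ballI)
  note E' = derivationD[OF lnd_derivation[OF E]]
  show "derivation R (\<lambda>x. t \<otimes> E x)"
    unfolding derivation_def using t E' by (auto simp: r_distr m_ac)
  fix b assume b: "b \<in> carrier R"
  have Et: "E (t [^] (j::nat)) = \<zero>" for j
    by (induction j) (auto simp: E' t derivation_one[OF lnd_derivation[OF E]])
  have "((\<lambda>x. t \<otimes> E x) ^^ j) b = t [^] j \<otimes> (E ^^ j) b" for j
    using t b derivation_funpow_closed[OF lnd_derivation[OF E] b]
    by (induction j) (auto simp: E' Et m_ac)
  moreover obtain n where "n > 0" "(E ^^ n) b = \<zero>"
    using E b by (auto simp: locally_nilpotent_derivation_def)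
  ultimately show "\<exists>n>0. ((\<lambda>x. t \<otimes> E x) ^^ n) b = \<zero>" using t by auto
qed

text \<open>Nilpotency at a polynomial holds because only finitely many coefficients are nonzero:
  the largest of their exponents works for all.\<close>

lemma lnd_UP:
  assumes D: "locally_nilpotent_derivation R D"
  shows "locally_nilpotent_derivation (UP R) (\<lambda>p n. D (p n))"
  unfolding locally_nilpotent_derivation_def
proof (intro conjI ballI)
  note D' = derivationD[OF lnd_derivation[OF D]]
  note D0 = derivation_zero[OF lnd_derivation[OF D]]
  have up: "(\<lambda>n. D (p n)) \<in> up R" if "p \<in> up R" for p
  proof -
    have "{n. D (p n) \<noteq> \<zero>} \<subseteq> {n. p n \<noteq> \<zero>}" using D0 by auto
    then show ?thesis using that by (auto simp: up_iff D' intro: finite_subset)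
  qed
  interpret U: cring "UP R" by (rule UP_is_cring)
  have c: "p n \<in> carrier R" if "p \<in> up R" for p n using that by (auto simp: up_iff)
  have mult: "(\<lambda>n. D ((p \<otimes>\<^bsub>UP R\<^esub> q) n)) =
      (\<lambda>n. D (p n)) \<otimes>\<^bsub>UP R\<^esub> q \<oplus>\<^bsub>UP R\<^esub> p \<otimes>\<^bsub>UP R\<^esub> (\<lambda>n. D (q n))"
    if p: "p \<in> up R" and q: "q \<in> up R" for p q
  proof
    fix n
    have m: "p' \<otimes>\<^bsub>UP R\<^esub> q' \<in> up R" if "p' \<in> up R" "q' \<in> up R" for p' q'
      using that U.m_closed by (simp add: UP_carrier)
    have "D ((p \<otimes>\<^bsub>UP R\<^esub> q) n) = (\<Oplus>i\<in>{..n}. D (p i \<otimes> q (n - i)))"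
      using c[OF p] c[OF q] by (simp add: UP_mult p q derivation_finsum[OF lnd_derivation[OF D]])
    also have "\<dots> = (\<Oplus>i\<in>{..n}. D (p i) \<otimes> q (n - i) \<oplus> p i \<otimes> D (q (n - i)))"
      using c[OF p] c[OF q] by (intro finsum_cong') (auto simp: D')
    also have "\<dots> = (\<Oplus>i\<in>{..n}. D (p i) \<otimes> q (n - i)) \<oplus> (\<Oplus>i\<in>{..n}. p i \<otimes> D (q (n - i)))"
      using c[OF p] c[OF q] by (intro finsum_addf) (auto simp: D')
    finally show "D ((p \<otimes>\<^bsub>UP R\<^esub> q) n) =
        ((\<lambda>n. D (p n)) \<otimes>\<^bsub>UP R\<^esub> q \<oplus>\<^bsub>UP R\<^esub> p \<otimes>\<^bsub>UP R\<^esub> (\<lambda>n. D (q n))) n"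
      using p q by (simp add: UP_add UP_mult up m)
  qed
  show "derivation (UP R) (\<lambda>p n. D (p n))"
    unfolding derivation_def using up mult c
    by (auto simp: UP_carrier UP_add D' fun_eq_iff)
  fix p assume "p \<in> carrier (UP R)"
  then have p: "p \<in> up R" by (simp add: UP_carrier)
  have pow: "((\<lambda>p n. D (p n)) ^^ j) p = (\<lambda>n. (D ^^ j) (p n))" for j
    by (induction j) auto
  have "\<exists>j. \<forall>m\<ge>j. (D ^^ m) (p n) = \<zero>" for n
    using lnd_funpow_zero[OF D c[OF p]] by metis
  then obtain J where J: "\<And>n m. m \<ge> J n \<Longrightarrow> (D ^^ m) (p n) = \<zero>" by metis
  \<comment> \<open>The inserted 1 makes N positive and keeps the set nonempty for the zero
    polynomial.\<close>
  define N where "N = Max (insert 1 (J ` {n. p n \<noteq> \<zero>}))"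
  have fin: "finite (insert 1 (J ` {n. p n \<noteq> \<zero>}))" using p by (simp add: up_iff)
  have "(D ^^ N) (p n) = \<zero>" for n
  proof (cases "p n = \<zero>")
    case True
    have "(D ^^ j) \<zero> = \<zero>" for j by (induction j) (auto simp: D0)
    then show ?thesis using True by simp
  next
    case False
    then have "J n \<le> N" unfolding N_def using fin by (intro Max_ge) auto
    then show ?thesis by (rule J)
  qed
  moreover have "N > 0" unfolding N_def using Max_ge[OF fin, of 1] by (simp del: Max_insert)
  ultimately show "\<exists>n>0. ((\<lambda>p n. D (p n)) ^^ n) p = \<zero>\<^bsub>UP R\<^esub>"
    by (auto simp: pow fun_eq_iff UP_zero)
qed

end

text \<open>Injectivity of \<open>\<psi>\<close> allows the Leibniz rule, additivity and nilpotency
  of \<open>\<delta>\<close> to be checked in U. It serves to pull a derivation of A[T] back to the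
  Veronese subring.\<close>

lemma lnd_restrict:
  assumes "ring S" "ring U" and hom: "\<psi> \<in> ring_hom S U" and inj: "inj_on \<psi> (carrier S)"
    and E: "locally_nilpotent_derivation U E"
    and stable: "\<And>x. x \<in> carrier S \<Longrightarrow> \<delta> x \<in> carrier S \<and> \<psi> (\<delta> x) = E (\<psi> x)"
  shows "locally_nilpotent_derivation S \<delta>"
proof -
  interpret S: ring S by fact
  interpret U: ring U by fact
  note E' = derivationD[OF lnd_derivation[OF E]]
  have eqI: "x = y" if "x \<in> carrier S" "y \<in> carrier S" "\<psi> x = \<psi> y" for x y
    using inj that by (auto dest: inj_onD)
  have \<psi>: "\<psi> x \<in> carrier U" if "x \<in> carrier S" for x
    using that by (rule ring_hom_closed[OF hom])
  have "derivation S \<delta>"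
    unfolding derivation_def
    by (auto intro!: eqI simp: stable ring_hom_add[OF hom] ring_hom_mult[OF hom] E' \<psi>)
  moreover have "\<exists>n>0. (\<delta> ^^ n) b = \<zero>\<^bsub>S\<^esub>" if b: "b \<in> carrier S" for b
  proof -
    have pow: "(\<delta> ^^ n) b \<in> carrier S \<and> \<psi> ((\<delta> ^^ n) b) = (E ^^ n) (\<psi> b)" for n
      by (induction n) (auto simp: b stable)
    obtain n where "n > 0" "(E ^^ n) (\<psi> b) = \<zero>\<^bsub>U\<^esub>"
      using E \<psi>[OF b] by (auto simp: locally_nilpotent_derivation_def)
    then show ?thesis
      using pow eqI[of _ "\<zero>\<^bsub>S\<^esub>"] ring_hom_zero[OF hom \<open>ring S\<close> \<open>ring U\<close>] by (metis S.zero_closed)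
  qed
  ultimately show ?thesis by (simp add: locally_nilpotent_derivation_def)
qed

text \<open>Each identity in V is the image of one in S, so the hypotheses list only closure of S
  and the behaviour of \<open>\<pi>\<close>. In this form it applies to the Veronese part of a
  quotient, of which just the carrier is described.\<close>

lemma lnd_image:
  assumes hom: "\<pi> \<in> ring_hom S V" and surj: "\<pi> ` carrier S = carrier V"
    and zero: "\<pi> \<zero>\<^bsub>S\<^esub> = \<zero>\<^bsub>V\<^esub>" "\<zero>\<^bsub>S\<^esub> \<in> carrier S"
    and \<delta>: "locally_nilpotent_derivation S \<delta>"
    and closed: "\<And>x y. x \<in> carrier S \<Longrightarrow> y \<in> carrier S \<Longrightarrow> x \<oplus>\<^bsub>S\<^esub> y \<in> carrier S"
      "\<And>x y. x \<in> carrier S \<Longrightarrow> y \<in> carrier S \<Longrightarrow> x \<otimes>\<^bsub>S\<^esub> y \<in> carrier S"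
    and stable: "\<And>x. x \<in> carrier S \<Longrightarrow> \<Delta> (\<pi> x) = \<pi> (\<delta> x)"
  shows "locally_nilpotent_derivation V \<Delta>"
proof -
  note \<delta>' = derivationD[OF lnd_derivation[OF \<delta>]]
  have "derivation V \<Delta>"
    unfolding derivation_def surj[symmetric]
    by (auto simp: stable \<delta>' closed ring_hom_add[OF hom, symmetric] ring_hom_mult[OF hom, symmetric])
  moreover have "\<exists>n>0. (\<Delta> ^^ n) b = \<zero>\<^bsub>V\<^esub>" if "b \<in> carrier V" for b
  proof -
    from that surj obtain x where x: "x \<in> carrier S" "b = \<pi> x" by auto
    have "(\<Delta> ^^ n) b = \<pi> ((\<delta> ^^ n) x)" for n
      using derivation_funpow_closed[OF lnd_derivation[OF \<delta>] x(1)]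
      by (induction n) (auto simp: x stable)
    moreover obtain n where "n > 0" "(\<delta> ^^ n) x = \<zero>\<^bsub>S\<^esub>"
      using \<delta> x by (auto simp: locally_nilpotent_derivation_def)
    ultimately show ?thesis using zero by auto
  qed
  ultimately show ?thesis by (simp add: locally_nilpotent_derivation_def)
qed

text \<open>Everything follows by cancelling t. For nilpotency, E is linear over powers of t, whence
  t^j \<open>\<delta>\<close>^j = E^j and t^n can be cancelled from t^n \<open>\<delta>\<close>^n b
  = 0.\<close>

lemma (in domain) lnd_divide:
  assumes E: "locally_nilpotent_derivation R E" and t: "t \<in> carrier R" "t \<noteq> \<zero>" "E t = \<zero>"
    and div: "\<And>x. x \<in> carrier R \<Longrightarrow> \<delta> x \<in> carrier R \<and> E x = t \<otimes> \<delta> x"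
  shows "locally_nilpotent_derivation R \<delta>"
  unfolding locally_nilpotent_derivation_def
proof (intro conjI ballI)
  note E' = derivationD[OF lnd_derivation[OF E]]
  have eqI: "x = y" if "x \<in> carrier R" "y \<in> carrier R" "t \<otimes> x = t \<otimes> y" for x y
    using that t m_lcancel by blast
  have d: "x \<in> carrier R \<Longrightarrow> \<delta> x \<in> carrier R" "x \<in> carrier R \<Longrightarrow> t \<otimes> \<delta> x = E x" for x
    using div by auto
  show der: "derivation R \<delta>"
    unfolding derivation_def
  proof (intro conjI ballI)
    show "\<delta> \<in> carrier R \<rightarrow> carrier R" using d by auto
    fix a b assume ab: "a \<in> carrier R" "b \<in> carrier R"
    show "\<delta> (a \<oplus> b) = \<delta> a \<oplus> \<delta> b"
      by (rule eqI) (use ab t in \<open>auto simp: d E' r_distr\<close>)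
    have "t \<otimes> (\<delta> a \<otimes> b \<oplus> a \<otimes> \<delta> b) = (t \<otimes> \<delta> a) \<otimes> b \<oplus> a \<otimes> (t \<otimes> \<delta> b)"
      using ab t d(1) by (simp add: r_distr m_ac)
    also have "\<dots> = t \<otimes> \<delta> (a \<otimes> b)"
      using ab by (simp add: d E')
    finally show "\<delta> (a \<otimes> b) = (\<delta> a \<otimes> b) \<oplus> (a \<otimes> \<delta> b)"
      by (rule eqI[OF _ _ sym, rotated 2]) (use ab d(1) in auto)
  qed
  fix b assume b: "b \<in> carrier R"
  have Et: "E (t [^] (j::nat)) = \<zero>" for j
    by (induction j) (auto simp: E' t derivation_one[OF lnd_derivation[OF E]])
  have c: "(\<delta> ^^ j) b \<in> carrier R" for j using derivation_funpow_closed[OF der b] .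
  have pow: "t [^] j \<otimes> (\<delta> ^^ j) b = (E ^^ j) b" for j
  proof (induction j)
    case 0 then show ?case using b by simp
  next
    case (Suc j)
    have "t [^] Suc j \<otimes> (\<delta> ^^ Suc j) b = t [^] j \<otimes> E ((\<delta> ^^ j) b)"
      using c d t by (simp add: m_assoc)
    also have "\<dots> = E (t [^] j \<otimes> (\<delta> ^^ j) b)"
      using c t by (simp add: E' Et)
    finally show ?case using Suc by simp
  qed
  obtain n where n: "n > 0" "(E ^^ n) b = \<zero>"
    using E b by (auto simp: locally_nilpotent_derivation_def)
  have "t [^] n \<otimes> (\<delta> ^^ n) b = \<zero>" using pow n by simp
  moreover have "t [^] n \<noteq> \<zero>" using t by (induction n) (auto simp: integral_iff)
  ultimately show "\<exists>n>0. (\<delta> ^^ n) b = \<zero>"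
    using n(1) c t integral by (metis nat_pow_closed)
qed

section \<open>The derivation of an additive group action\<close>

context cring
begin

section \<open>Coefficients of powers of T + T' in R[T][T']\<close>

context
  fixes P Q z
  defines "P \<equiv> UP R" and "Q \<equiv> UP (UP R)"
    and "z \<equiv> monom (UP (UP R)) (monom (UP R) \<one> 1) 0 \<oplus>\<^bsub>UP (UP R)\<^esub> monom (UP (UP R)) \<one>\<^bsub>UP R\<^esub> 1"
begin

interpretation P: UP_cring R P
  by (simp_all add: UP_cring_def cring_axioms P_def)

interpretation Q: UP_cring P Q
  by (simp_all add: UP_cring_def UP_is_cring P_def Q_def)

lemma shift_sum_eq: "z = monom Q (monom P \<one> 1) 0 \<oplus>\<^bsub>Q\<^esub> monom Q \<one>\<^bsub>P\<^esub> 1"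
  by (simp add: z_def P_def Q_def)

lemma shift_sum_carrier: "z \<in> carrier Q"
  by (simp add: shift_sum_eq)

text \<open>The outer index n is the exponent of T' and the inner index j that of T; the two
  summands of \<open>z\<close> = T + T' each lower one of them by 1.\<close>

lemma shift_sum_mult:
  assumes "q \<in> carrier Q"
  shows "coeff P (coeff Q (q \<otimes>\<^bsub>Q\<^esub> z) n) j =
    (if j = 0 then \<zero> else coeff P (coeff Q q n) (j - 1))
      \<oplus> (if n = 0 then \<zero> else coeff P (coeff Q q (n - 1)) j)"
proof -
  have "q \<otimes>\<^bsub>Q\<^esub> z = monom Q (monom P \<one> 1) 0 \<otimes>\<^bsub>Q\<^esub> q \<oplus>\<^bsub>Q\<^esub> monom Q \<one>\<^bsub>P\<^esub> 1 \<otimes>\<^bsub>Q\<^esub> q"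
    unfolding shift_sum_eq using assms by (simp add: Q.P.r_distr Q.P.m_comm)
  moreover have "coeff Q (monom Q (monom P \<one> 1) 0 \<otimes>\<^bsub>Q\<^esub> q) n = monom P \<one> 1 \<otimes>\<^bsub>P\<^esub> coeff Q q n"
    using Q.coeff_monom_mult[of "monom P \<one> 1" q 0 n] assms by simp
  moreover have "coeff P (monom P \<one> 1 \<otimes>\<^bsub>P\<^esub> p) j = (if j = 0 then \<zero> else coeff P p (j - 1))"
    if "p \<in> carrier P" for p
    using P.coeff_monom_mult[of \<one> p 1 "j - 1"] that by (cases "j = 0") (simp, simp del: P.coeff_mult)
  moreover have "coeff Q (monom Q \<one>\<^bsub>P\<^esub> 1 \<otimes>\<^bsub>Q\<^esub> q) n = (if n = 0 then \<zero>\<^bsub>P\<^esub> else coeff Q q (n - 1))"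
    using Q.coeff_monom_mult[of "\<one>\<^bsub>P\<^esub>" q 1 "n - 1"] assms
    by (cases "n = 0") (simp, simp del: Q.coeff_mult)
  ultimately show ?thesis using assms by simp
qed

text \<open>These are the terms T'^i and i T T'^(i-1) of (T + T')^i. The recursion of
  \<open>shift_sum_mult\<close> closes on the exponents 0 and 1 of T.\<close>

lemma shift_sum_power:
  "coeff P (coeff Q (z [^]\<^bsub>Q\<^esub> i) n) 0 = (if n = i then \<one> else \<zero>) \<and>
   coeff P (coeff Q (z [^]\<^bsub>Q\<^esub> i) n) 1 = (if i = Suc n then [i] \<cdot> \<one> else \<zero>)"
proof (induction i arbitrary: n)
  case 0
  then show ?case by simp
next
  case (Suc i)
  have "z [^]\<^bsub>Q\<^esub> i \<in> carrier Q" using shift_sum_carrier by simp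
  from shift_sum_mult[OF this] Suc show ?case
    by (auto simp: a_comm)
qed

text \<open>Comparing the coefficients of \<open>T T'\<^sup>n\<close> in \<open>\<Sum>\<^sub>i p\<^sub>i (T + T')\<^sup>i\<close>.\<close>

lemma eval_shift_sum:
  assumes p: "p \<in> carrier P"
  shows "coeff P (coeff Q (eval R Q (\<lambda>x. monom Q (monom P x 0) 0) z p) n) 1
    = [(Suc n)] \<cdot> coeff P p (Suc n)"
proof -
  let ?h = "\<lambda>x. monom Q (monom P x 0) 0"
  let ?t = "\<lambda>i. ?h (coeff P p i) \<otimes>\<^bsub>Q\<^esub> z [^]\<^bsub>Q\<^esub> i"
  have zi: "z [^]\<^bsub>Q\<^esub> i \<in> carrier Q" for i :: nat using shift_sum_carrier by simp
  have t: "?t i \<in> carrier Q" for i using p zi by simp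
  have ct: "coeff P (coeff Q (?t i) n) 1 = (if Suc n = i then [i] \<cdot> coeff P p i else \<zero>)" for i
  proof -
    have "coeff Q (?t i) n = monom P (coeff P p i) 0 \<otimes>\<^bsub>P\<^esub> coeff Q (z [^]\<^bsub>Q\<^esub> i) n"
      using Q.coeff_monom_mult[of "monom P (coeff P p i) 0" "z [^]\<^bsub>Q\<^esub> i" 0 n] p zi by simp
    moreover have "coeff P (monom P (coeff P p i) 0 \<otimes>\<^bsub>P\<^esub> coeff Q (z [^]\<^bsub>Q\<^esub> i) n) 1
        = coeff P p i \<otimes> coeff P (coeff Q (z [^]\<^bsub>Q\<^esub> i) n) 1"
      using P.coeff_monom_mult[of "coeff P p i" "coeff Q (z [^]\<^bsub>Q\<^esub> i) n" 0 1] p zi by simp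
    ultimately show ?thesis
      using p shift_sum_power[of i n] by (simp add: add_pow_rdistr del: One_nat_def)
  qed
  have "eval R Q ?h z p = (\<Oplus>\<^bsub>Q\<^esub>i\<in>{..deg R p}. ?t i)"
    using p by (simp add: eval_def P_def)
  then have "coeff P (coeff Q (eval R Q ?h z p) n) 1
      = (\<Oplus>i\<in>{..deg R p}. if Suc n = i then [i] \<cdot> coeff P p i else \<zero>)"
    using t by (simp add: Q.coeff_finsum P.coeff_finsum ct Pi_def del: One_nat_def)
  also have "\<dots> = [(Suc n)] \<cdot> coeff P p (Suc n)"
  proof (cases "Suc n \<le> deg R p")
    case True
    then show ?thesis
      using finsum_singleton[of "Suc n" "{..deg R p}" "\<lambda>i. [i] \<cdot> coeff P p i"] p by auto
  next
    case False
    then have "coeff P p (Suc n) = \<zero>" using P.deg_aboveD[of p "Suc n"] p by simp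
    with False show ?thesis by (auto intro!: add.finprod_one_eqI)
  qed
  finally show ?thesis .
qed

end

lemma eval_zero:
  assumes "p \<in> carrier (UP R)"
  shows "eval R R (\<lambda>x. x) \<zero> p = coeff (UP R) p 0"
proof -
  interpret P: UP_cring R "UP R"
    by (simp add: UP_cring_def cring_axioms)
  have "eval R R (\<lambda>x. x) \<zero> p = (\<Oplus>i\<in>{..deg R p}. if 0 = i then coeff (UP R) p i else \<zero>)"
    using assms by (auto simp: eval_def nat_pow_zero intro!: finsum_cong')
  then show ?thesis
    using finsum_singleton[of 0 "{..deg R p}" "coeff (UP R) p"] assms by auto
qed

lemma derivation_add_pow:
  assumes "derivation R D" "a \<in> carrier R"
  shows "D ([(n::nat)] \<cdot> a) = [n] \<cdot> D a"
proof (induction n)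
  case 0
  have "D \<zero> = D (\<zero> \<oplus> \<zero>)" by simp
  also have "\<dots> = D \<zero> \<oplus> D \<zero>" using assms(1) unfolding derivation_def by blast
  finally have "D \<zero> = \<zero>" using assms(1) unfolding derivation_def by (auto simp: Pi_def)
  then show ?case by simp
next
  case (Suc n)
  then show ?case using assms by (simp add: derivation_def)
qed

end

text \<open>D is the linear coefficient of \<open>\<rho>\<close>, the derivative of the action at
  time 0. Comparing coefficients of T T'^n in the associativity law gives D (\<open>\<rho>\<close>_n
  a) = (n+1) \<open>\<rho>\<close>_(n+1) a. Hence the iterates of D are multiples of the
  coefficients, which vanish beyond the degree of \<open>\<rho> a\<close>; and if D were 0, absence
  of torsion would make all coefficients of positive index vanish, so the action would be
  trivial.\<close>

lemma Ga_action_imp_lnd: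
  assumes "cring A" and act: "Ga_action k A \<rho>"
    and const: "\<And>c. c \<in> carrier k \<Longrightarrow> c \<odot>\<^bsub>A\<^esub> \<one>\<^bsub>A\<^esub> \<in> carrier A"
    and tf: "\<And>n a. n > 0 \<Longrightarrow> a \<in> carrier A \<Longrightarrow> [(n::nat)] \<cdot>\<^bsub>A\<^esub> a = \<zero>\<^bsub>A\<^esub> \<Longrightarrow> a = \<zero>\<^bsub>A\<^esub>"
    and nontriv: "a0 \<in> carrier A" "\<rho> a0 \<noteq> monom (UP A) a0 0"
  obtains D where "locally_nilpotent_derivation A D"
    "\<And>c. c \<in> carrier k \<Longrightarrow> D (c \<odot>\<^bsub>A\<^esub> \<one>\<^bsub>A\<^esub>) = \<zero>\<^bsub>A\<^esub>"
    "\<exists>a\<in>carrier A. D a \<noteq> \<zero>\<^bsub>A\<^esub>"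
proof
  interpret cring A by fact
  interpret P: UP_cring A "UP A"
    by (simp add: UP_cring_def cring_axioms)
  have hom: "\<rho> \<in> ring_hom A (UP A)" using act by (simp add: Ga_action_def)
  have \<rho>c: "\<rho> a \<in> carrier (UP A)" if "a \<in> carrier A" for a
    using that by (rule ring_hom_closed[OF hom])
  let ?c = "\<lambda>a n. coeff (UP A) (\<rho> a) n"
  define D where "D a = ?c a 1" for a
  have c0: "?c a 0 = a" if "a \<in> carrier A" for a
    using act that eval_zero[OF \<rho>c] by (simp add: Ga_action_def)
  have Dc: "D (?c a n) = [(Suc n)] \<cdot>\<^bsub>A\<^esub> ?c a (Suc n)" if a: "a \<in> carrier A" for a n
  proof -
    let ?E = "eval A (UP (UP A)) (\<lambda>x. monom (UP (UP A)) (monom (UP A) x 0) 0)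
      (monom (UP (UP A)) (monom (UP A) \<one>\<^bsub>A\<^esub> 1) 0
         \<oplus>\<^bsub>UP (UP A)\<^esub> monom (UP (UP A)) \<one>\<^bsub>UP A\<^esub> 1) (\<rho> a)"
    have "(\<lambda>n. \<rho> (?c a n)) = ?E"
      using act a by (simp add: Ga_action_def)
    \<comment> \<open>The left-hand side of the associativity law is a bare function;
      \<open>coeff\<close> reads it correctly only inside \<open>up\<close>, so finite support is
      checked here.\<close>
    moreover have "(\<lambda>n. \<rho> (?c a n)) \<in> up (UP A)"
    proof -
      have "\<rho> (?c a n) = \<zero>\<^bsub>UP A\<^esub>" if "n > deg A (\<rho> a)" for n
        using P.deg_aboveD[OF that \<rho>c[OF a]] ring_hom_zero[OF hom] cring_axioms UP_is_cring
        by (simp add: cring.axioms(1))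
      then have "{n. \<rho> (?c a n) \<noteq> \<zero>\<^bsub>UP A\<^esub>} \<subseteq> {..deg A (\<rho> a)}"
        by (force simp: not_less[symmetric])
      then show ?thesis using a \<rho>c by (auto simp: up_iff intro: finite_subset)
    qed
    ultimately have "coeff (UP (UP A)) ?E n = \<rho> (?c a n)" by (metis coeff_UP)
    then show ?thesis using eval_shift_sum[OF \<rho>c[OF a], of n] by (simp add: D_def)
  qed
  have der: "derivation A D"
    unfolding derivation_def D_def
    using \<rho>c c0 by (auto simp: ring_hom_add[OF hom] ring_hom_mult[OF hom] a_comm)
  \<comment> \<open>The multiplier is i factorial, built up by one factor \<open>Suc i\<close> per
    step.\<close>
  have pow: "\<exists>m>0. (D ^^ i) a = [(m::nat)] \<cdot>\<^bsub>A\<^esub> ?c a i" if a: "a \<in> carrier A" for a i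
  proof (induction i)
    case 0
    show ?case using a c0 by (auto intro!: exI[of _ 1])
  next
    case (Suc i)
    then obtain m :: nat where m: "m > 0" "(D ^^ i) a = [m] \<cdot>\<^bsub>A\<^esub> ?c a i" by blast
    then have "(D ^^ Suc i) a = [m] \<cdot>\<^bsub>A\<^esub> ([(Suc i)] \<cdot>\<^bsub>A\<^esub> ?c a (Suc i))"
      using derivation_add_pow[OF der] Dc a \<rho>c by (simp del: add.nat_pow_Suc)
    also have "\<dots> = [(m * Suc i)] \<cdot>\<^bsub>A\<^esub> ?c a (Suc i)"
      using a \<rho>c by (simp only: add.nat_pow_pow P.coeff_closed mult.commute)
    finally show ?case using m(1) by (metis nat_0_less_mult_iff zero_less_Suc)
  qed
  show "locally_nilpotent_derivation A D"
    unfolding locally_nilpotent_derivation_def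
  proof (intro conjI ballI der)
    fix a assume a: "a \<in> carrier A"
    have "?c a (Suc (deg A (\<rho> a))) = \<zero>\<^bsub>A\<^esub>"
      using P.deg_aboveD[OF _ \<rho>c[OF a]] by simp
    then show "\<exists>n>0. (D ^^ n) a = \<zero>\<^bsub>A\<^esub>"
      using pow[OF a, of "Suc (deg A (\<rho> a))"] by auto
  qed
  show "D (c \<odot>\<^bsub>A\<^esub> \<one>\<^bsub>A\<^esub>) = \<zero>\<^bsub>A\<^esub>" if "c \<in> carrier k" for c
  proof -
    have "\<rho> (c \<odot>\<^bsub>A\<^esub> \<one>\<^bsub>A\<^esub>) = monom (UP A) (c \<odot>\<^bsub>A\<^esub> \<one>\<^bsub>A\<^esub>) 0"
      using act that unfolding Ga_action_def by blast
    then show ?thesis using const[OF that] by (simp add: D_def)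
  qed
  show "\<exists>a\<in>carrier A. D a \<noteq> \<zero>\<^bsub>A\<^esub>"
  proof (rule ccontr)
    assume "\<not> ?thesis"
    then have "[(Suc n)] \<cdot>\<^bsub>A\<^esub> ?c a0 (Suc n) = \<zero>\<^bsub>A\<^esub>" for n
      using Dc[OF nontriv(1), of n] \<rho>c nontriv(1) by auto
    then have "?c a0 (Suc n) = \<zero>\<^bsub>A\<^esub>" for n
      by (rule tf[OF zero_less_Suc P.coeff_closed[OF \<rho>c[OF nontriv(1)]]])
    then have "?c a0 n = coeff (UP A) (monom (UP A) a0 0) n" for n
      using c0 nontriv(1) by (cases n) auto
    then have "\<rho> a0 = monom (UP A) a0 0"
      using P.up_eqI \<rho>c nontriv(1) by auto
    with nontriv(2) show False by contradiction
  qed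
qed

section \<open>Dehomogenization\<close>

text \<open>Elements of K[H] presented as sums of single terms, so that an additive property can be
  proved term by term. Zero is not a constructor; it is obtained as 1 - 1.\<close>

inductive_set monomial_span :: "('a, 'm) ring_scheme \<Rightarrow> 'a set \<Rightarrow> 'a set \<Rightarrow> 'a set"
  for R (structure) and K H where
    monomial: "c \<in> K \<Longrightarrow> c \<otimes> (\<Otimes>h\<in>H. h [^] (\<alpha> h :: nat)) \<in> monomial_span R K H"
  | add: "x \<in> monomial_span R K H \<Longrightarrow> y \<in> monomial_span R K H \<Longrightarrow> x \<oplus> y \<in> monomial_span R K H"

section \<open>Spans of monomials contain the ring generated by coefficients and generators\<close>

context cring
begin

abbreviation monomial :: "'a set \<Rightarrow> ('a \<Rightarrow> nat) \<Rightarrow> 'a"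
  where "monomial H \<alpha> \<equiv> (\<Otimes>h\<in>H. h [^] \<alpha> h)"

lemma monomial_closed: "H \<subseteq> carrier R \<Longrightarrow> monomial H \<alpha> \<in> carrier R"
  by (intro finprod_closed) auto

lemma monomial_add:
  assumes "H \<subseteq> carrier R"
  shows "monomial H (\<lambda>h. \<alpha> h + \<beta> h) = monomial H \<alpha> \<otimes> monomial H \<beta>"
proof -
  have "monomial H (\<lambda>h. \<alpha> h + \<beta> h) = (\<Otimes>h\<in>H. h [^] \<alpha> h \<otimes> h [^] \<beta> h)"
    using assms by (intro finprod_cong') (auto simp: nat_pow_mult)
  also have "\<dots> = monomial H \<alpha> \<otimes> monomial H \<beta>"
    using assms by (intro finprod_multf) auto
  finally show ?thesis .
qed

context
  fixes K H
  assumes K: "K \<subseteq> carrier R" "\<one> \<in> K" "\<And>a. a \<in> K \<Longrightarrow> \<ominus> a \<in> K"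
      "\<And>a b. a \<in> K \<Longrightarrow> b \<in> K \<Longrightarrow> a \<otimes> b \<in> K"
    and H: "H \<subseteq> carrier R" "finite H"
begin

lemma monomial_span_closed: "x \<in> monomial_span R K H \<Longrightarrow> x \<in> carrier R"
  by (induction rule: monomial_span.induct) (use K monomial_closed[OF H(1)] in auto)

lemma monomial_span_minus: "x \<in> monomial_span R K H \<Longrightarrow> \<ominus> x \<in> monomial_span R K H"
proof (induction rule: monomial_span.induct)
  case (monomial c \<alpha>)
  then have "\<ominus> (c \<otimes> monomial H \<alpha>) = (\<ominus> c) \<otimes> monomial H \<alpha>"
    using K(1) monomial_closed[OF H(1)] by (simp add: l_minus subset_iff)
  then show ?case using monomial_span.monomial[OF K(3)[OF monomial]] by simp
next
  case (add x y)
  then show ?case by (simp add: minus_add monomial_span_closed monomial_span.add)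
qed

lemma monomial_span_mult:
  assumes "x \<in> monomial_span R K H" "y \<in> monomial_span R K H"
  shows "x \<otimes> y \<in> monomial_span R K H"
  using assms(1)
proof (induction rule: monomial_span.induct)
  case (monomial c \<alpha>)
  note c = monomial
  show ?case using assms(2)
  proof (induction rule: monomial_span.induct)
    case (monomial b \<beta>)
    have "(c \<otimes> monomial H \<alpha>) \<otimes> (b \<otimes> monomial H \<beta>)
        = (c \<otimes> b) \<otimes> monomial H (\<lambda>h. \<alpha> h + \<beta> h)"
      using K(1) c monomial monomial_closed[OF H(1)]
      by (simp add: monomial_add[OF H(1)] m_ac subset_iff)
    then show ?case using monomial_span.monomial[OF K(4)[OF c monomial]] by metis
  next
    case (add x y)
    have "c \<otimes> monomial H \<alpha> \<in> carrier R" using c K(1) monomial_closed[OF H(1)] by auto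
    with add show ?case by (simp add: r_distr monomial_span_closed monomial_span.add)
  qed
next
  case (add x x')
  then show ?case using assms(2) by (simp add: l_distr monomial_span_closed monomial_span.add)
qed

lemma generate_ring_monomial_span:
  assumes L: "L \<subseteq> monomial_span R K H"
  shows "generate_ring R L \<subseteq> monomial_span R K H"
proof
  have one: "\<one> \<in> monomial_span R K H"
    using monomial_span.monomial[where R = R and H = H and \<alpha> = "\<lambda>_. 0", OF K(2)]
    by (simp add: finprod_one_eqI)
  fix x assume "x \<in> generate_ring R L"
  then show "x \<in> monomial_span R K H"
    by induction (use L one in \<open>auto intro: monomial_span_minus monomial_span.add monomial_span_mult\<close>)
qed

lemma coefficient_in_monomial_span: "c \<in> K \<Longrightarrow> c \<in> monomial_span R K H"
  using monomial_span.monomial[where R = R and H = H and \<alpha> = "\<lambda>_. 0", of c K] K(1)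
  by (auto simp: finprod_one_eqI)

lemma generator_in_monomial_span:
  assumes "h \<in> H" shows "h \<in> monomial_span R K H"
proof -
  have "monomial H (\<lambda>h'. if h = h' then 1 else 0) = (\<Otimes>h'\<in>H. if h = h' then h' else \<one>)"
    using H by (intro finprod_cong') auto
  also have "\<dots> = h"
    using finprod_singleton[of h H "\<lambda>h. h"] assms H by auto
  finally have "\<one> \<otimes> monomial H (\<lambda>h'. if h = h' then 1 else 0) = h" using assms H by auto
  then show ?thesis
    using monomial_span.monomial[where R = R and H = H, OF K(2)] by metis
qed

end
end

text \<open>\<open>A\<close> is the degree-zero part of the localization at \<open>F\<close>, and \<open>\<phi> n a\<close> is \<open>a / F\<^sup>n\<close>.\<close>

locale dehomogenization = graded_cring R gr + domain R for R (structure) and gr +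
  fixes F :: 'a and d :: nat and A :: "('c, 'q) ring_scheme" and \<phi> :: "nat \<Rightarrow> 'a \<Rightarrow> 'c"
  assumes F: "F \<in> gr d" "F \<noteq> \<zero>" and d: "d > 0"
    and \<phi>_closed: "a \<in> gr (n * d) \<Longrightarrow> \<phi> n a \<in> carrier A"
    and \<phi>_add: "a \<in> gr (n * d) \<Longrightarrow> b \<in> gr (n * d) \<Longrightarrow> \<phi> n (a \<oplus> b) = \<phi> n a \<oplus>\<^bsub>A\<^esub> \<phi> n b"
    and \<phi>_mult: "a \<in> gr (m * d) \<Longrightarrow> b \<in> gr (n * d) \<Longrightarrow> \<phi> (m + n) (a \<otimes> b) = \<phi> m a \<otimes>\<^bsub>A\<^esub> \<phi> n b"
    and \<phi>_one: "\<phi> 0 \<one> = \<one>\<^bsub>A\<^esub>" and \<phi>_zero: "\<phi> 0 \<zero> = \<zero>\<^bsub>A\<^esub>"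
    and \<phi>_F: "a \<in> gr (n * d) \<Longrightarrow> \<phi> (Suc n) (F \<otimes> a) = \<phi> n a"
    and \<phi>_inj: "a \<in> gr (n * d) \<Longrightarrow> b \<in> gr (n * d) \<Longrightarrow> \<phi> n a = \<phi> n b \<Longrightarrow> a = b"
    and \<phi>_surj: "x \<in> carrier A \<Longrightarrow> \<exists>n. \<exists>a\<in>gr (n * d). x = \<phi> n a"
begin

lemma F_closed: "F \<in> carrier R" using F gr_carrier by blast

lemma raise_gr: "a \<in> gr (n * d) \<Longrightarrow> F [^] (m::nat) \<otimes> a \<in> gr ((m + n) * d)"
  using gr_mult[OF pow_gr[OF F(1), of m], of a "n * d"] by (simp add: add_mult_distrib)

lemma \<phi>_raise: "a \<in> gr (n * d) \<Longrightarrow> \<phi> (m + n) (F [^] (m::nat) \<otimes> a) = \<phi> n a"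
proof (induction m)
  case 0 then show ?case by (simp add: gr_carrier)
next
  case (Suc m)
  have "F [^] Suc m \<otimes> a = F \<otimes> (F [^] m \<otimes> a)"
    using F_closed gr_carrier[OF Suc.prems] by (simp add: m_ac)
  then show ?case using \<phi>_F[OF raise_gr[OF Suc.prems, of m]] Suc by simp
qed

lemma \<phi>_level:
  assumes "a \<in> gr (n * d)" "n \<le> m"
  shows "\<exists>b\<in>gr (m * d). \<phi> n a = \<phi> m b"
  using \<phi>_raise[OF assms(1), of "m - n"] raise_gr[OF assms(1), of "m - n"] assms(2)
  by (metis le_add_diff_inverse2)

lemma \<phi>_n_zero: "\<phi> n \<zero> = \<zero>\<^bsub>A\<^esub>"
  using \<phi>_raise[of \<zero> 0 n] F_closed by (simp add: gr_zero \<phi>_zero)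

lemma common_level:
  assumes "finite X" "X \<subseteq> carrier A"
  shows "\<exists>n. \<forall>x\<in>X. \<exists>a\<in>gr (n * d). x = \<phi> n a"
  using assms
proof (induction X rule: finite_induct)
  case (insert x X)
  then obtain n m a where n: "\<forall>x\<in>X. \<exists>a\<in>gr (n * d). x = \<phi> n a" and a: "a \<in> gr (m * d)" "x = \<phi> m a"
    using \<phi>_surj[of x] by auto
  have "\<exists>b\<in>gr ((n + m) * d). y = \<phi> (n + m) b" if "y \<in> insert x X" for y
    using that n a \<phi>_level[of _ n "n + m"] \<phi>_level[OF a(1), of "n + m"] by (metis insert_iff le_add1 le_add2)
  then show ?case by blast
qed auto

text \<open>\<open>A\<close> is just a structure receiving the maps \<open>\<phi> n\<close>.
  Finitely many elements have a common denominator F^n, and at that level each ring law is the image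
  of the same law in \<open>R\<close>.\<close>

lemma A_cring: "cring A"
proof -
  have three: "\<exists>n. \<exists>a\<in>gr (n * d). \<exists>b\<in>gr (n * d). \<exists>c\<in>gr (n * d). x = \<phi> n a \<and> y = \<phi> n b \<and> z = \<phi> n c"
    if "x \<in> carrier A" "y \<in> carrier A" "z \<in> carrier A" for x y z
    using common_level[of "{x, y, z}"] that by simp
  note gr' = gr_carrier gr_add gr_mult[where m = "_ * d" and n = "_ * d", folded add_mult_distrib]
  have one: "\<one> \<in> gr (0 * d)" using one_gr by simp
  have zero: "\<zero> \<in> gr (0 * d)" by (rule gr_zero)
  show ?thesis
  proof (intro cringI abelian_groupI comm_monoidI)
    show "\<zero>\<^bsub>A\<^esub> \<in> carrier A" "\<one>\<^bsub>A\<^esub> \<in> carrier A"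
      using \<phi>_closed[OF one] \<phi>_closed[OF zero] by (auto simp: \<phi>_one \<phi>_zero)
    fix x y assume xy: "x \<in> carrier A" "y \<in> carrier A"
    obtain n a b where ab: "a \<in> gr (n * d)" "b \<in> gr (n * d)" "x = \<phi> n a" "y = \<phi> n b"
      using three[OF xy xy(1)] by blast
    show "x \<oplus>\<^bsub>A\<^esub> y \<in> carrier A" "x \<otimes>\<^bsub>A\<^esub> y \<in> carrier A"
      using ab \<phi>_closed[OF gr'(2)[OF ab(1,2)]] \<phi>_closed[OF gr'(3)[OF ab(1,2)]]
      by (simp_all add: \<phi>_add \<phi>_mult)
    show "x \<oplus>\<^bsub>A\<^esub> y = y \<oplus>\<^bsub>A\<^esub> x" "x \<otimes>\<^bsub>A\<^esub> y = y \<otimes>\<^bsub>A\<^esub> x"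
      using ab \<phi>_mult[OF ab(1,2)] \<phi>_mult[OF ab(2,1)]
      by (simp_all add: \<phi>_add[symmetric] gr_carrier a_comm m_comm)
    show "\<one>\<^bsub>A\<^esub> \<otimes>\<^bsub>A\<^esub> x = x" "\<zero>\<^bsub>A\<^esub> \<oplus>\<^bsub>A\<^esub> x = x"
      using ab \<phi>_mult[OF one ab(1)] \<phi>_add[OF gr_zero ab(1)]
      by (simp_all add: \<phi>_one \<phi>_n_zero gr_carrier)
    show "\<exists>y\<in>carrier A. y \<oplus>\<^bsub>A\<^esub> x = \<zero>\<^bsub>A\<^esub>"
      using ab \<phi>_closed[OF gr_minus[OF ab(1)]] \<phi>_add[OF gr_minus[OF ab(1)] ab(1)]
      by (intro bexI[of _ "\<phi> n (\<ominus> a)"]) (simp_all add: \<phi>_n_zero gr_carrier l_neg)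
  next
    fix x y z assume xyz: "x \<in> carrier A" "y \<in> carrier A" "z \<in> carrier A"
    obtain n a b c where abc: "a \<in> gr (n * d)" "b \<in> gr (n * d)" "c \<in> gr (n * d)"
        "x = \<phi> n a" "y = \<phi> n b" "z = \<phi> n c"
      using three[OF xyz] by blast
    show "(x \<oplus>\<^bsub>A\<^esub> y) \<oplus>\<^bsub>A\<^esub> z = x \<oplus>\<^bsub>A\<^esub> (y \<oplus>\<^bsub>A\<^esub> z)"
      using abc by (simp add: \<phi>_add[symmetric] gr_add gr_carrier a_assoc)
    show "(x \<otimes>\<^bsub>A\<^esub> y) \<otimes>\<^bsub>A\<^esub> z = x \<otimes>\<^bsub>A\<^esub> (y \<otimes>\<^bsub>A\<^esub> z)"
      using abc gr'(3) by (simp add: \<phi>_mult[symmetric] gr_carrier m_assoc add.assoc)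
    show "(x \<oplus>\<^bsub>A\<^esub> y) \<otimes>\<^bsub>A\<^esub> z = x \<otimes>\<^bsub>A\<^esub> z \<oplus>\<^bsub>A\<^esub> y \<otimes>\<^bsub>A\<^esub> z"
      using abc gr'(3) gr_add by (simp add: \<phi>_mult[symmetric] \<phi>_add[symmetric] gr_carrier l_distr)
  qed
qed

sublocale A: cring A by (rule A_cring)

text \<open>\<open>D\<close> sends the element \<open>a / F\<^sup>n\<close> of \<open>A\<^sub>n\<close> into \<open>A\<^sub>n\<^sub>+\<^sub>e\<close>.\<close>

definition shifts :: "('c \<Rightarrow> 'c) \<Rightarrow> nat \<Rightarrow> nat \<Rightarrow> 'a \<Rightarrow> bool" where
  "shifts D e n a \<longleftrightarrow> a \<in> gr (n * d) \<and> (\<exists>b\<in>gr ((n + e) * d). D (\<phi> n a) = \<phi> (n + e) b)"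

section \<open>A uniform bound on how far a derivation raises the filtration\<close>

context
  fixes D
  assumes D: "derivation A D"
begin

lemma shifts_mono: "shifts D e n a \<Longrightarrow> e \<le> e' \<Longrightarrow> shifts D e' n a"
  unfolding shifts_def using \<phi>_level by (metis add_le_cancel_left)

lemma ex_shifts:
  assumes "a \<in> gr (n * d)" shows "\<exists>e. shifts D e n a"
proof -
  have "D (\<phi> n a) \<in> carrier A" using derivationD(1)[OF D \<phi>_closed[OF assms]] .
  then obtain m b where "b \<in> gr (m * d)" "D (\<phi> n a) = \<phi> m b" using \<phi>_surj by blast
  then have "\<exists>b\<in>gr ((n + m) * d). D (\<phi> n a) = \<phi> (n + m) b" using \<phi>_level by simp
  then show ?thesis using assms by (auto simp: shifts_def)
qed

lemma ex_uniform_shifts: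
  assumes "finite T" "\<And>n a. (n, a) \<in> T \<Longrightarrow> a \<in> gr (n * d)"
  shows "\<exists>e. \<forall>(n, a)\<in>T. shifts D e n a"
  using assms
proof (induction T rule: finite_induct)
  case (insert t T)
  obtain n a where t: "t = (n, a)" by fastforce
  obtain e where e: "\<forall>(n, a)\<in>T. shifts D e n a" using insert by auto
  obtain e' where e': "shifts D e' n a" using ex_shifts insert.prems t by blast
  have "\<forall>(n, a)\<in>insert t T. shifts D (max e e') n a"
    using e e' t by (auto intro: shifts_mono)
  then show ?case by blast
qed auto

lemma shifts_zero: "shifts D e n \<zero>"
  unfolding shifts_def using gr_zero by (metis A.derivation_zero[OF D] \<phi>_n_zero)

lemma shifts_add: "shifts D e n a \<Longrightarrow> shifts D e n b \<Longrightarrow> shifts D e n (a \<oplus> b)"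
  unfolding shifts_def by (metis \<phi>_add \<phi>_closed derivationD(2)[OF D] gr_add)

text \<open>The bound e does not double: in each Leibniz term only one factor is differentiated, so
  the level rises by e once.\<close>

lemma shifts_mult:
  assumes a: "shifts D e m a" and b: "shifts D e n b"
  shows "shifts D e (m + n) (a \<otimes> b)"
proof -
  note gr_mult' = gr_mult[where m = "_ * d" and n = "_ * d", folded add_mult_distrib]
  obtain a' b' where a': "a \<in> gr (m * d)" "a' \<in> gr ((m + e) * d)" "D (\<phi> m a) = \<phi> (m + e) a'"
    and b': "b \<in> gr (n * d)" "b' \<in> gr ((n + e) * d)" "D (\<phi> n b) = \<phi> (n + e) b'"
    using a b by (auto simp: shifts_def)
  have eq: "m + e + n = m + n + e" "m + (n + e) = m + n + e" by auto
  have "D (\<phi> (m + n) (a \<otimes> b)) = D (\<phi> m a) \<otimes>\<^bsub>A\<^esub> \<phi> n b \<oplus>\<^bsub>A\<^esub> \<phi> m a \<otimes>\<^bsub>A\<^esub> D (\<phi> n b)"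
    using a' b' by (simp add: \<phi>_mult \<phi>_closed derivationD(3)[OF D])
  also have "\<dots> = \<phi> (m + e + n) (a' \<otimes> b) \<oplus>\<^bsub>A\<^esub> \<phi> (m + (n + e)) (a \<otimes> b')"
    using a' b' by (simp add: \<phi>_mult)
  also have "\<dots> = \<phi> (m + n + e) (a' \<otimes> b \<oplus> a \<otimes> b')"
    using gr_mult'[OF a'(2) b'(1)] gr_mult'[OF a'(1) b'(2)] unfolding eq by (simp add: \<phi>_add)
  finally show ?thesis
    using gr_mult'[OF a'(2) b'(1)] gr_mult'[OF a'(1) b'(2)] gr_mult'[OF a'(1) b'(1)]
    unfolding eq shifts_def by (auto intro: gr_add)
qed


text \<open>The numerator 0 lies in every degree, so constants admit any e.\<close>

lemma shifts_constant:
  assumes "c \<in> gr 0" "D (\<phi> 0 c) = \<zero>\<^bsub>A\<^esub>"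
  shows "shifts D e 0 c"
  unfolding shifts_def using assms gr_zero[of "e * d"] \<phi>_n_zero[of e, symmetric]
  by (auto intro!: bexI[of _ \<zero>])

lemma shifts_one: "shifts D e 0 \<one>"
  by (rule shifts_constant) (simp_all add: one_gr \<phi>_one A.derivation_one[OF D])

lemma shifts_pow: "shifts D e n a \<Longrightarrow> shifts D e (q * n) (a [^] (q :: nat))"
proof (induction q)
  case (Suc q)
  then show ?case using shifts_mult[of e "q * n" "a [^] q" n a] by (simp add: add.commute)
qed (simp add: shifts_one)

lemma shifts_finprod:
  assumes "finite H" "\<And>h. h \<in> H \<Longrightarrow> shifts D e (w h) (f h)"
  shows "shifts D e (\<Sum>h\<in>H. w h) (\<Otimes>h\<in>H. f h)"
  using assms
proof (induction H rule: finite_induct)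
  case (insert h H)
  then have "f h \<in> carrier R" "f \<in> H \<rightarrow> carrier R"
    unfolding shifts_def by (blast intro: gr_carrier)+
  with insert shifts_mult[of e "w h" "f h" "\<Sum>h\<in>H. w h" "\<Otimes>h\<in>H. f h"] show ?case by simp
qed (simp add: shifts_one)

lemma finprod_gr:
  assumes "finite H" "\<And>h. h \<in> H \<Longrightarrow> f h \<in> gr (w h)"
  shows "(\<Otimes>h\<in>H. f h) \<in> gr (\<Sum>h\<in>H. w h)"
  using assms
proof (induction H rule: finite_induct)
  case (insert h H)
  then have "f h \<in> carrier R" "f \<in> H \<rightarrow> carrier R"
    by (blast intro: gr_carrier)+
  with insert gr_mult[of "f h" "w h"] show ?case by simp
qed (simp add: one_gr)

text \<open>Write the exponents of a monomial in homogeneous generators as \<open>d q + r\<close> with \<open>r < d\<close>. If \<open>d\<close>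
  divides its degree, the monomial is a product of \<open>d\<close>-th powers of generators and of the remainder,
  which is one of finitely many monomials whose degree is divisible by \<open>d\<close>.\<close>

lemma ex_shifts_all_monomials:
  assumes H: "finite H" "\<And>h. h \<in> H \<Longrightarrow> h \<in> gr (w h)"
  obtains e where "\<And>\<alpha> n. (\<Sum>h\<in>H. \<alpha> h * w h) = n * d \<Longrightarrow> shifts D e n (monomial H \<alpha>)"
proof -
  define wt where "wt \<alpha> = (\<Sum>h\<in>H. \<alpha> h * w h)" for \<alpha>
  have Hc: "H \<subseteq> carrier R" using H(2) gr_carrier by blast
  have mon_gr: "monomial H \<alpha> \<in> gr (wt \<alpha>)" for \<alpha>
    unfolding wt_def by (intro finprod_gr H(1) pow_gr H(2))
  define T1 where "T1 = (\<lambda>r. (wt r div d, monomial H r)) ` {r \<in> H \<rightarrow>\<^sub>E {..<d}. d dvd wt r}"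
  define T2 where "T2 = (\<lambda>h. (w h, h [^] d)) ` H"
  have "finite (T1 \<union> T2)"
    unfolding T1_def T2_def using H(1) finite_PiE[OF H(1), of "\<lambda>_. {..<d}"] by simp
  moreover have "a \<in> gr (n * d)" if "(n, a) \<in> T1 \<union> T2" for n a
    using that mon_gr pow_gr[OF H(2), of _ d] by (auto simp: T1_def T2_def mult.commute)
  ultimately obtain e where e: "\<forall>(n, a)\<in>T1 \<union> T2. shifts D e n a"
    using ex_uniform_shifts by blast
  have "shifts D e n (monomial H \<alpha>)" if n: "wt \<alpha> = n * d" for \<alpha> n
  proof -
    \<comment> \<open>The restriction to H puts the remainder vector into the extensional function
      space indexing \<open>T1\<close>, which is finite.\<close>
    define r where "r = restrict (\<lambda>h. \<alpha> h mod d) H"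
    define q where "q h = \<alpha> h div d" for h
    have \<alpha>: "\<alpha> h = d * q h + r h" if "h \<in> H" for h
      using that by (simp add: r_def q_def)
    have "wt \<alpha> = (\<Sum>h\<in>H. d * (q h * w h) + r h * w h)"
      unfolding wt_def by (intro sum.cong) (simp_all add: \<alpha> algebra_simps)
    then have wt: "wt \<alpha> = d * (\<Sum>h\<in>H. q h * w h) + wt r"
      by (simp add: sum.distrib sum_distrib_left wt_def)
    then have "d dvd wt r"
      using n by (metis dvd_add_right_iff dvd_triv_left dvd_triv_right)
    moreover have "r \<in> H \<rightarrow>\<^sub>E {..<d}" using d by (auto simp: r_def)
    ultimately have r: "shifts D e (wt r div d) (monomial H r)"
      using e by (auto simp: T1_def)
    have "shifts D e (\<Sum>h\<in>H. q h * w h) (\<Otimes>h\<in>H. (h [^] d) [^] q h)"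
      using e by (intro shifts_finprod H(1) shifts_pow) (auto simp: T2_def)
    from shifts_mult[OF this r]
    have "shifts D e ((\<Sum>h\<in>H. q h * w h) + wt r div d) ((\<Otimes>h\<in>H. (h [^] d) [^] q h) \<otimes> monomial H r)" .
    moreover have "(\<Sum>h\<in>H. q h * w h) + wt r div d = n"
    proof -
      have "d * ((\<Sum>h\<in>H. q h * w h) + wt r div d) = d * n"
        using wt n \<open>d dvd wt r\<close> by (simp add: algebra_simps)
      then show ?thesis using d by simp
    qed
    moreover have "(\<Otimes>h\<in>H. (h [^] d) [^] q h) \<otimes> monomial H r = monomial H \<alpha>"
    proof -
      have "(\<Otimes>h\<in>H. (h [^] d) [^] q h) = monomial H (\<lambda>h. d * q h)"
        using Hc by (intro finprod_cong') (auto simp: nat_pow_pow)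
      moreover have "monomial H (\<lambda>h. d * q h + r h) = monomial H \<alpha>"
        using Hc by (intro finprod_cong') (auto simp: \<alpha>)
      ultimately show ?thesis by (simp add: monomial_add[OF Hc])
    qed
    ultimately show ?thesis by simp
  qed
  then show thesis using that unfolding wt_def by blast
qed

text \<open>Every element is a sum of monomials in homogeneous generators with coefficients killed
  by D. The bound for monomials of degree divisible by d is uniform, and the coefficients leave it
  unchanged.\<close>

lemma ex_shifts_all:
  assumes G: "finite G" "G \<subseteq> carrier R" and gen: "carrier R = generate_ring R (K \<union> G)"
    and K: "K \<subseteq> gr 0" "\<And>c. c \<in> K \<Longrightarrow> D (\<phi> 0 c) = \<zero>\<^bsub>A\<^esub>"
  obtains e where "\<And>n a. a \<in> gr (n * d) \<Longrightarrow> shifts D e n a"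
proof -
  \<comment> \<open>K is merely a set of coefficients. The degree-zero elements killed by D contain
    it and have the closure under negation and products that the monomial span requires.\<close>
  define K' where "K' = {c \<in> gr 0. D (\<phi> 0 c) = \<zero>\<^bsub>A\<^esub>}"
  have \<phi>0: "\<phi> 0 a \<in> carrier A" "\<phi> 0 (a \<oplus> b) = \<phi> 0 a \<oplus>\<^bsub>A\<^esub> \<phi> 0 b" "\<phi> 0 (a \<otimes> b) = \<phi> 0 a \<otimes>\<^bsub>A\<^esub> \<phi> 0 b"
    if "a \<in> gr 0" "b \<in> gr 0" for a b
    using that \<phi>_closed[of a 0] \<phi>_add[of a 0 b] \<phi>_mult[of a 0 b 0] by simp_all
  have K'_minus: "\<ominus> a \<in> K'" if a: "a \<in> K'" for a
  proof -
    have a: "a \<in> gr 0" "D (\<phi> 0 a) = \<zero>\<^bsub>A\<^esub>" using a by (simp_all add: K'_def)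
    note m = gr_minus[OF a(1)]
    have c: "D (\<phi> 0 (\<ominus> a)) \<in> carrier A" using derivationD(1)[OF D \<phi>0(1)[OF m m]] .
    have "\<zero>\<^bsub>A\<^esub> = D (\<phi> 0 (a \<oplus> \<ominus> a))"
      using gr_carrier[OF a(1)] by (simp add: r_neg \<phi>_zero A.derivation_zero[OF D])
    also have "\<dots> = D (\<phi> 0 a) \<oplus>\<^bsub>A\<^esub> D (\<phi> 0 (\<ominus> a))"
      using \<phi>0(2)[OF a(1) m] derivationD(2)[OF D \<phi>0(1)[OF a(1) m] \<phi>0(1)[OF m m]] by simp
    finally show ?thesis using a m c by (simp add: K'_def)
  qed
  have K'_mult: "a \<otimes> b \<in> K'" if "a \<in> K'" "b \<in> K'" for a b
    using that gr_mult[of a 0 b 0] \<phi>0 by (simp add: K'_def derivationD(3)[OF D])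
  have K': "K' \<subseteq> carrier R" "\<one> \<in> K'" "K \<subseteq> K'"
    using K by (auto simp: K'_def gr_carrier one_gr \<phi>_one A.derivation_one[OF D])
  \<comment> \<open>The generators are replaced by their nonzero components, which makes each
    monomial homogeneous.\<close>
  define H where "H = (\<Union>g\<in>G. hcomp g ` {n. hcomp g n \<noteq> \<zero>})"
  have H: "finite H" using G finite_hcomp by (auto simp: H_def)
  have Hc: "H \<subseteq> carrier R" using G(2) by (auto simp: H_def hcomp_carrier)
  have "\<forall>h\<in>H. \<exists>n. h \<in> gr n" using G(2) hcomp_gr by (auto simp: H_def)
  then obtain w where w: "\<And>h. h \<in> H \<Longrightarrow> h \<in> gr (w h)" by metis
  note span = K'(1,2) K'_minus K'_mult Hc H
  have span_zero: "\<zero> \<in> monomial_span R K' H"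
    using monomial_span.add[OF coefficient_in_monomial_span[OF span K'(2)]
        monomial_span_minus[OF span coefficient_in_monomial_span[OF span K'(2)]]]
    by (simp add: r_neg)
  have span_sum: "(\<Oplus>i\<in>I. f i) \<in> monomial_span R K' H"
    if "\<And>i. i \<in> I \<Longrightarrow> f i \<in> monomial_span R K' H" for I and f :: "nat \<Rightarrow> 'a"
    using that
  proof (induction I rule: infinite_finite_induct)
    case (insert i I)
    moreover have "f i \<in> carrier R" "f \<in> I \<rightarrow> carrier R"
      using insert.prems monomial_span_closed[OF span] by auto
    ultimately show ?case by (simp add: monomial_span.add)
  qed (auto simp: span_zero)
  have "g \<in> monomial_span R K' H" if g: "g \<in> G" for g
  proof -
    have gc: "g \<in> carrier R" using g G(2) by auto
    have "hcomp g n \<in> monomial_span R K' H" if "hcomp g n \<noteq> \<zero>" for n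
      using generator_in_monomial_span[OF span] g that by (auto simp: H_def)
    then show ?thesis using span_sum[of _ "hcomp g"] hcomp_sum[OF gc] by (metis (mono_tags, lifting) mem_Collect_eq)
  qed
  then have "K \<union> G \<subseteq> monomial_span R K' H"
    using K'(3) coefficient_in_monomial_span[OF span] by auto
  then have R_span: "carrier R \<subseteq> monomial_span R K' H"
    using gen generate_ring_monomial_span[OF span] by simp
  obtain e where e: "\<And>\<alpha> n. (\<Sum>h\<in>H. \<alpha> h * w h) = n * d \<Longrightarrow> shifts D e n (monomial H \<alpha>)"
    using ex_shifts_all_monomials[OF H w] by blast
  \<comment> \<open>Summands of a homogeneous element may have other degrees that cancel, so the
    induction runs over arbitrary x and follows its component of degree \<open>n * d\<close>; a term
    of another degree contributes 0 to it.\<close>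
  have comp: "shifts D e n (hcomp x (n * d))" if "x \<in> monomial_span R K' H" for x n
    using that
  proof (induction rule: monomial_span.induct)
    case (monomial c \<alpha>)
    have c: "shifts D e 0 c" "c \<in> gr 0"
      using monomial shifts_constant by (auto simp: K'_def)
    let ?wt = "\<Sum>h\<in>H. \<alpha> h * w h"
    have "monomial H \<alpha> \<in> gr ?wt"
      by (intro finprod_gr H pow_gr w)
    from gr_mult[OF c(2) this] have "c \<otimes> monomial H \<alpha> \<in> gr ?wt" by simp
    from hcomp_homogeneous[OF this] show ?case
      using shifts_mult[OF c(1) e[of \<alpha> n]] shifts_zero by auto
  next
    case (add x y)
    then show ?case using monomial_span_closed[OF span] by (simp add: hcomp_add shifts_add)
  qed
  have "shifts D e n a" if "a \<in> gr (n * d)" for n a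
    using comp[of a n] R_span gr_carrier[OF that] hcomp_homogeneous[OF that] by auto
  then show thesis using that by blast
qed

end
end

section \<open>The Veronese ring as a Rees algebra\<close>

context graded_cring
begin

text \<open>The Veronese subring, described by a condition on components instead of by sums, so that
  membership can be tested.\<close>

definition supported_degrees :: "nat \<Rightarrow> 'a set" where
  "supported_degrees d = {x \<in> carrier R. \<forall>n. hcomp x n \<noteq> \<zero> \<longrightarrow> d dvd n}"

lemma supported_degrees_carrier: "x \<in> supported_degrees d \<Longrightarrow> x \<in> carrier R"
  by (simp add: supported_degrees_def)

lemma homogeneous_supported: "a \<in> gr (n * d) \<Longrightarrow> a \<in> supported_degrees d"
  using gr_carrier[of a "n * d"] hcomp_homogeneous[of a "n * d"]
  by (auto simp: supported_degrees_def split: if_splits)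

lemma supported_degrees_subring: "subring (supported_degrees d) R"
proof (rule subringI)
  show "supported_degrees d \<subseteq> carrier R" by (auto simp: supported_degrees_def)
  show "\<one> \<in> supported_degrees d" using homogeneous_supported[of \<one> 0 d] one_gr by simp
  show "\<ominus> x \<in> supported_degrees d" if "x \<in> supported_degrees d" for x
    using that by (auto simp: supported_degrees_def hcomp_minus) (metis minus_zero)
  fix x y assume xy: "x \<in> supported_degrees d" "y \<in> supported_degrees d"
  then have c: "x \<in> carrier R" "y \<in> carrier R" by (auto simp: supported_degrees_def)
  have "d dvd n" if "hcomp (x \<oplus> y) n \<noteq> \<zero>" for n
  proof (rule ccontr)
    assume "\<not> d dvd n"
    then have "hcomp x n = \<zero>" "hcomp y n = \<zero>" using xy by (auto simp: supported_degrees_def)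
    then show False using that by (simp add: hcomp_add[OF c])
  qed
  then show "x \<oplus> y \<in> supported_degrees d" using c by (simp add: supported_degrees_def)
  have "d dvd n" if "hcomp (x \<otimes> y) n \<noteq> \<zero>" for n
  proof -
    have "\<exists>i\<in>{..n}. hcomp x i \<otimes> hcomp y (n - i) \<noteq> \<zero>"
    proof (rule ccontr)
      assume "\<not> ?thesis"
      then have "hcomp (x \<otimes> y) n = \<zero>"
        unfolding hcomp_mult[OF c] by (intro add.finprod_one_eqI) simp
      with that show False by contradiction
    qed
    then obtain i where i: "i \<le> n" "hcomp x i \<otimes> hcomp y (n - i) \<noteq> \<zero>" by auto
    then have "hcomp x i \<noteq> \<zero>" "hcomp y (n - i) \<noteq> \<zero>" using c by (auto simp: hcomp_carrier)
    then have "d dvd i" "d dvd (n - i)" using xy by (auto simp: supported_degrees_def)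
    then show ?thesis using i(1) by (metis dvd_add le_add_diff_inverse)
  qed
  then show "x \<otimes> y \<in> supported_degrees d" using c by (simp add: supported_degrees_def)
qed

text \<open>Only indices divisible by d survive for x, and reindexing by i \<mapsto> i d turns the
  convolution into that of polynomials in one variable of degree d. This is what makes
  \<open>rees\<close> multiplicative.\<close>

lemma hcomp_mult_supported:
  assumes x: "x \<in> supported_degrees d" and y: "y \<in> carrier R" and d: "d > 0"
  shows "hcomp (x \<otimes> y) (n * d) = (\<Oplus>i\<in>{..n}. hcomp x (i * d) \<otimes> hcomp y ((n - i) * d))"
proof -
  have xc: "x \<in> carrier R" using x by (rule supported_degrees_carrier)
  have "hcomp (x \<otimes> y) (n * d) = (\<Oplus>j\<in>{..n * d}. hcomp x j \<otimes> hcomp y (n * d - j))"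
    by (rule hcomp_mult[OF xc y])
  also have "\<dots> = (\<Oplus>j\<in>(\<lambda>i. i * d) ` {..n}. hcomp x j \<otimes> hcomp y (n * d - j))"
  proof (rule add.finprod_mono_neutral_cong_right)
    have "hcomp x j = \<zero>" if "j \<in> {..n * d} - (\<lambda>i. i * d) ` {..n}" for j
    proof (rule ccontr)
      assume "hcomp x j \<noteq> \<zero>"
      then obtain i where "j = i * d" using x by (force simp: supported_degrees_def mult.commute)
      with that d show False by auto
    qed
    then show "\<And>j. j \<in> {..n * d} - (\<lambda>i. i * d) ` {..n} \<Longrightarrow> hcomp x j \<otimes> hcomp y (n * d - j) = \<zero>"
      using y by (simp add: hcomp_carrier)
  qed (use xc y in \<open>auto simp: hcomp_carrier\<close>)
  also have "\<dots> = (\<Oplus>i\<in>{..n}. hcomp x (i * d) \<otimes> hcomp y (n * d - i * d))"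
    using xc y d by (intro finsum_reindex) (auto simp: hcomp_carrier inj_on_def)
  also have "\<dots> = (\<Oplus>i\<in>{..n}. hcomp x (i * d) \<otimes> hcomp y ((n - i) * d))"
    using xc y by (intro finsum_cong') (auto simp: hcomp_carrier diff_mult_distrib)
  finally show ?thesis .
qed

end

context dehomogenization
begin

abbreviation ver :: "('a, 'b) ring_scheme"
  where "ver \<equiv> R\<lparr>carrier := supported_degrees d\<rparr>"

lemma ver_ring: "ring ver"
  using subring_is_ring[OF supported_degrees_subring] .

lemma ver_domain: "domain ver"
  using subdomain_is_domain[OF subdomainI'[OF supported_degrees_subring]] .

definition rees :: "'a \<Rightarrow> nat \<Rightarrow> 'c" where
  "rees x n = \<phi> n (hcomp x (n * d))"

lemma \<phi>_finsum:
  "(\<And>i. i \<in> I \<Longrightarrow> f i \<in> gr (n * d)) \<Longrightarrow> \<phi> n (\<Oplus>i\<in>I. f i) = (\<Oplus>\<^bsub>A\<^esub>i\<in>I. \<phi> n (f i))"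
proof (induction I rule: infinite_finite_induct)
  case (insert i I)
  have "f i \<in> carrier R" "f \<in> I \<rightarrow> carrier R" "(\<lambda>i. \<phi> n (f i)) \<in> I \<rightarrow> carrier A" "\<phi> n (f i) \<in> carrier A"
    using insert.prems by (auto intro: gr_carrier \<phi>_closed)
  with insert \<phi>_add[OF _ gr_finsum[of I f "n * d"], of "f i"] show ?case by simp
qed (auto simp: \<phi>_n_zero)

lemma rees_up:
  assumes "x \<in> carrier R" shows "rees x \<in> up A"
proof -
  have "finite ((\<lambda>n. n * d) -` {n. hcomp x n \<noteq> \<zero>})"
    using finite_hcomp[OF assms] d by (intro finite_vimageI) (auto simp: inj_on_def)
  moreover have "{n. rees x n \<noteq> \<zero>\<^bsub>A\<^esub>} \<subseteq> (\<lambda>n. n * d) -` {n. hcomp x n \<noteq> \<zero>}"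
    by (auto simp: rees_def \<phi>_n_zero)
  ultimately show ?thesis
    using assms by (auto simp: up_iff rees_def \<phi>_closed hcomp_gr intro: finite_subset)
qed

lemma rees_hom: "rees \<in> ring_hom ver (UP A)"
proof (rule ring_hom_memI)
  fix x y assume "x \<in> carrier ver" "y \<in> carrier ver"
  then have xy: "x \<in> supported_degrees d" "y \<in> supported_degrees d"
    and c: "x \<in> carrier R" "y \<in> carrier R" by (auto simp: supported_degrees_def)
  show "rees x \<in> carrier (UP A)" using c by (simp add: UP_carrier rees_up)
  show "rees (x \<oplus>\<^bsub>ver\<^esub> y) = rees x \<oplus>\<^bsub>UP A\<^esub> rees y"
    using c by (intro ext) (simp add: UP_add rees_up, simp add: rees_def hcomp_add \<phi>_add hcomp_gr)
  show "rees (x \<otimes>\<^bsub>ver\<^esub> y) = rees x \<otimes>\<^bsub>UP A\<^esub> rees y"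
  proof
    fix n
    have g: "hcomp x (i * d) \<otimes> hcomp y ((n - i) * d) \<in> gr (n * d)" if "i \<le> n" for i
      using gr_mult[OF hcomp_gr hcomp_gr, OF c, of "i * d" "(n - i) * d"] that
      by (simp flip: add_mult_distrib)
    have "rees (x \<otimes> y) n = (\<Oplus>\<^bsub>A\<^esub>i\<in>{..n}. \<phi> n (hcomp x (i * d) \<otimes> hcomp y ((n - i) * d)))"
      unfolding rees_def hcomp_mult_supported[OF xy(1) c(2) d] by (rule \<phi>_finsum) (simp add: g)
    also have "\<dots> = (\<Oplus>\<^bsub>A\<^esub>i\<in>{..n}. rees x i \<otimes>\<^bsub>A\<^esub> rees y (n - i))"
    proof (rule A.finsum_cong')
      fix i assume "i \<in> {..n}"
      then show "\<phi> n (hcomp x (i * d) \<otimes> hcomp y ((n - i) * d)) = rees x i \<otimes>\<^bsub>A\<^esub> rees y (n - i)"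
        using \<phi>_mult[OF hcomp_gr hcomp_gr, OF c, of i "n - i"] by (simp add: rees_def)
    qed (use rees_up c in \<open>auto simp: up_iff\<close>)
    finally show "rees (x \<otimes>\<^bsub>ver\<^esub> y) n = (rees x \<otimes>\<^bsub>UP A\<^esub> rees y) n"
      using c by (simp add: UP_mult rees_up)
  qed
next
  show "rees \<one>\<^bsub>ver\<^esub> = \<one>\<^bsub>UP A\<^esub>"
    using d by (auto simp: rees_def UP_one hcomp_homogeneous[OF one_gr] \<phi>_one \<phi>_n_zero)
qed

lemma rees_inj: "inj_on rees (supported_degrees d)"
proof (rule inj_onI)
  fix x y assume xy: "x \<in> supported_degrees d" "y \<in> supported_degrees d" and eq: "rees x = rees y"
  then have c: "x \<in> carrier R" "y \<in> carrier R" by (auto simp: supported_degrees_def)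
  have "hcomp x m = hcomp y m" for m
  proof (cases "d dvd m")
    case True
    then obtain n where m: "m = n * d" by (metis dvd_def mult.commute)
    have "\<phi> n (hcomp x m) = \<phi> n (hcomp y m)" using fun_cong[OF eq, of n] by (simp add: rees_def m)
    then show ?thesis using \<phi>_inj hcomp_gr c m by blast
  next
    case False
    then have "hcomp x m = \<zero>" "hcomp y m = \<zero>" using xy by (auto simp: supported_degrees_def)
    then show ?thesis by simp
  qed
  then show "x = y" using hcomp_inj c by blast
qed

text \<open>F has level 1 and F / F = 1, so its image is the variable T.\<close>

lemma rees_F: "rees F n = (if n = 1 then \<one>\<^bsub>A\<^esub> else \<zero>\<^bsub>A\<^esub>)"
  using \<phi>_F[of \<one> 0] d F_closed
  by (auto simp: rees_def hcomp_homogeneous[OF F(1)] one_gr \<phi>_one \<phi>_n_zero)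

text \<open>T^e times the coefficientwise D moves D (x_n / F^n) into coefficient n + e, where
  \<open>shifts\<close> permits the denominator F^(n+e); so the image of \<open>rees\<close> is
  preserved. F = T is killed because D 1 = 0, and a numerator of y witnesses that the result is
  nonzero.\<close>

lemma ex_lnd_ver:
  assumes D: "locally_nilpotent_derivation A D"
    and e: "\<And>n a. a \<in> gr (n * d) \<Longrightarrow> shifts D e n a"
    and nz: "y \<in> carrier A" "D y \<noteq> \<zero>\<^bsub>A\<^esub>"
  obtains \<delta> x where "locally_nilpotent_derivation ver \<delta>" "\<delta> F = \<zero>"
    "x \<in> supported_degrees d" "\<delta> x \<noteq> \<zero>"
proof -
  interpret U: UP_cring A "UP A"
    by (simp add: UP_cring_def A_cring)
  note D0 = A.derivation_zero[OF lnd_derivation[OF D]]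
  note D1 = A.derivation_one[OF lnd_derivation[OF D]]
  define t where "t = monom (UP A) \<one>\<^bsub>A\<^esub> e"
  define E where "E p = t \<otimes>\<^bsub>UP A\<^esub> (\<lambda>n. D (p n))" for p
  have E: "locally_nilpotent_derivation (UP A) E"
    unfolding E_def
    by (rule U.P.lnd_scale[OF A.lnd_UP[OF D]])
      (auto simp: t_def UP_monom D0 D1 fun_eq_iff UP_zero)
  have Dup: "(\<lambda>n. D (p n)) \<in> up A" if "p \<in> up A" for p
    using derivationD(1)[OF lnd_derivation[OF A.lnd_UP[OF D]], of p] that by (simp add: UP_carrier)
  have E_eq: "E p n = (if e \<le> n then D (p (n - e)) else \<zero>\<^bsub>A\<^esub>)" if p: "p \<in> up A" for p n
  proof (cases "e \<le> n")
    case True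
    have "coeff (UP A) (t \<otimes>\<^bsub>UP A\<^esub> (\<lambda>n. D (p n))) (n - e + e)
        = \<one>\<^bsub>A\<^esub> \<otimes>\<^bsub>A\<^esub> coeff (UP A) (\<lambda>n. D (p n)) (n - e)"
      unfolding t_def by (rule U.coeff_monom_mult) (simp_all add: UP_carrier Dup p)
    moreover have "t \<otimes>\<^bsub>UP A\<^esub> (\<lambda>n. D (p n)) \<in> up A"
      using U.UP_mult_closed[of t "\<lambda>n. D (p n)"] Dup[OF p] U.monom_closed[of "\<one>\<^bsub>A\<^esub>" e]
      by (simp add: t_def UP_carrier)
    ultimately show ?thesis
      using True Dup[OF p] by (simp add: coeff_UP E_def up_iff)
  next
    case False
    have "t \<in> up A" using U.monom_closed[of "\<one>\<^bsub>A\<^esub>" e] by (simp add: t_def UP_carrier)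
    then have "E p n = (\<Oplus>\<^bsub>A\<^esub>i\<in>{..n}. t i \<otimes>\<^bsub>A\<^esub> D (p (n - i)))"
      using Dup[OF p] by (simp add: E_def UP_mult)
    also have "\<dots> = \<zero>\<^bsub>A\<^esub>"
      using False Dup[OF p] by (intro A.add.finprod_one_eqI) (auto simp: t_def UP_monom up_iff)
    finally show ?thesis using False by simp
  qed
  have "\<exists>z\<in>supported_degrees d. rees z = E (rees x)" if x: "x \<in> supported_degrees d" for x
  proof -
    have xc: "x \<in> carrier R" using x by (rule supported_degrees_carrier)
    have "\<forall>n. \<exists>b\<in>gr ((n + e) * d). D (rees x n) = \<phi> (n + e) b"
      using e[OF hcomp_gr[OF xc]] by (simp add: shifts_def rees_def)
    then obtain b where b: "\<And>n. b n \<in> gr ((n + e) * d)" "\<And>n. D (rees x n) = \<phi> (n + e) (b n)"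
      by metis
    \<comment> \<open>The chosen numerators are forced to be 0 wherever the coefficient is 0; this
      gives f finite support.\<close>
    have b0: "b n = \<zero>" if "rees x n = \<zero>\<^bsub>A\<^esub>" for n
      using b(2)[of n] that \<phi>_inj[OF b(1) gr_zero] by (simp add: D0 \<phi>_n_zero)
    \<comment> \<open>f places b n in degree \<open>(n + e) * d\<close>. The guard
      \<open>e \<le> m div d\<close> protects against truncated subtraction.\<close>
    define f where "f m = (if d dvd m \<and> e \<le> m div d then b (m div d - e) else \<zero>)" for m
    have f_gr: "f m \<in> gr m" for m
      using b(1)[of "m div d - e"] by (auto simp: f_def gr_zero)
    have "{m. f m \<noteq> \<zero>} \<subseteq> (\<lambda>n. (n + e) * d) ` {n. rees x n \<noteq> \<zero>\<^bsub>A\<^esub>}"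
    proof
      fix m assume "m \<in> {m. f m \<noteq> \<zero>}"
      then have "d dvd m" "e \<le> m div d" "b (m div d - e) \<noteq> \<zero>" by (auto simp: f_def split: if_splits)
      then show "m \<in> (\<lambda>n. (n + e) * d) ` {n. rees x n \<noteq> \<zero>\<^bsub>A\<^esub>}"
        using b0 by (intro image_eqI[of _ _ "m div d - e"]) auto
    qed
    then have "finite {m. f m \<noteq> \<zero>}"
      using rees_up[OF xc] by (auto simp: up_iff intro: finite_subset)
    then have f_up: "f \<in> up R" using f_gr by (auto simp: up_iff intro: gr_carrier)
    define z where "z = eval1 f"
    have z: "z \<in> carrier R" "hcomp z = f"
      using ring_hom_closed[OF eval1_hom] f_up hcomp_eqI[OF f_up f_gr]
      by (auto simp: z_def UP_carrier)
    have "z \<in> supported_degrees d" using z by (auto simp: supported_degrees_def f_def)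
    moreover have "rees z n = E (rees x) n" for n
      using d b(2)[of "n - e"]
      by (auto simp: E_eq[OF rees_up[OF xc]] rees_def[of z] z f_def \<phi>_n_zero)
    ultimately show ?thesis by blast
  qed
  then obtain \<delta> where \<delta>: "\<And>x. x \<in> supported_degrees d \<Longrightarrow> \<delta> x \<in> supported_degrees d \<and> rees (\<delta> x) = E (rees x)"
    by metis
  have rees0: "rees \<zero> = (\<lambda>n. \<zero>\<^bsub>A\<^esub>)" by (auto simp: rees_def hcomp_zero \<phi>_n_zero)
  obtain n a where a: "a \<in> gr (n * d)" "y = \<phi> n a" using \<phi>_surj nz(1) by blast
  show thesis
  proof
    show "locally_nilpotent_derivation ver \<delta>"
      by (rule lnd_restrict[OF ver_ring _ rees_hom _ E])
        (use \<delta> rees_inj A.UP_is_cring in \<open>auto simp: cring.axioms\<close>)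
    have Fs: "F \<in> supported_degrees d" using homogeneous_supported[of F 1 d] F by simp
    have "rees (\<delta> F) = rees \<zero>"
      using \<delta>[OF Fs] F_closed by (auto simp: E_eq rees_up rees_F D0 D1 rees0)
    then show "\<delta> F = \<zero>"
      using rees_inj \<delta>[OF Fs] homogeneous_supported[OF gr_zero] by (blast dest: inj_onD)
    show as: "a \<in> supported_degrees d" using homogeneous_supported a by blast
    show "\<delta> a \<noteq> \<zero>"
    proof
      assume "\<delta> a = \<zero>"
      then have "E (rees a) = rees \<zero>" using \<delta>[OF as] by simp
      then have "E (rees a) (n + e) = \<zero>\<^bsub>A\<^esub>" by (simp add: rees0)
      then have "D y = \<zero>\<^bsub>A\<^esub>"
        using a gr_carrier[OF a(1)] by (simp add: E_eq rees_up) (simp add: rees_def hcomp_homogeneous[OF a(1)])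
      with nz(2) show False by contradiction
    qed
  qed
qed

text \<open>A derivation of the Veronese subring that kills \<open>F\<close> can be divided by \<open>F\<close> as long as all its
  values are divisible by \<open>F\<close>; the degrees of the values bound how often this happens.\<close>

lemma ex_lnd_ver_nonzero_mod:
  assumes \<delta>: "locally_nilpotent_derivation ver \<delta>" "\<delta> F = \<zero>"
    and x: "x \<in> supported_degrees d" "\<delta> x \<noteq> \<zero>"
  obtains \<delta>' z where "locally_nilpotent_derivation ver \<delta>'" "\<delta>' F = \<zero>"
    "z \<in> supported_degrees d" "\<And>y. y \<in> supported_degrees d \<Longrightarrow> \<delta>' z \<noteq> F \<otimes> y"
proof -
  interpret V: domain ver by (rule ver_domain)
  define P where "P m \<longleftrightarrow> (\<exists>\<delta>'. locally_nilpotent_derivation ver \<delta>' \<and> \<delta>' F = \<zero> \<and>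
      (\<forall>z\<in>supported_degrees d. \<delta> z = F [^] m \<otimes> \<delta>' z))" for m :: nat
  have cl: "\<delta>' z \<in> carrier R" if "locally_nilpotent_derivation ver \<delta>'" "z \<in> supported_degrees d" for \<delta>' z
    using derivationD(1)[OF lnd_derivation[OF that(1)], of z] that(2) by (simp add: supported_degrees_carrier)
  have Fs: "F \<in> supported_degrees d" using homogeneous_supported[of F 1 d] F by simp
  have P0: "P 0" unfolding P_def using \<delta> cl[OF \<delta>(1)] by (intro exI[of _ \<delta>]) auto
  have "finite {n. hcomp (\<delta> x) n \<noteq> \<zero>}" using finite_hcomp cl \<delta>(1) x(1) by blast
  then obtain N where N: "\<And>n. hcomp (\<delta> x) n \<noteq> \<zero> \<Longrightarrow> n < N"
    by (meson finite_nat_set_iff_bounded mem_Collect_eq)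
  have bound: "m \<le> N" if Pm: "P m" for m
  proof (rule ccontr)
    assume "\<not> m \<le> N"
    then have mN: "N < m * d" using d by (metis le_less_trans mult.commute mult_le_mono1 nat_mult_1 not_le Suc_leI One_nat_def less_le_trans)
    obtain \<delta>' where \<delta>': "locally_nilpotent_derivation ver \<delta>'" "\<delta> x = F [^] m \<otimes> \<delta>' x"
      using Pm x(1) unfolding P_def by blast
    \<comment> \<open>A multiple of F^m has no components below degree \<open>m * d\<close>, whereas
      \<open>\<delta> x\<close> has none from N on; with N < m d nothing is left.\<close>
    have "hcomp (\<delta> x) n = \<zero>" for n
      using N[of n] hcomp_mult_homogeneous[OF pow_gr[OF F(1), of m] cl[OF \<delta>'(1) x(1)], of n] mN \<delta>'(2)
      by (metis less_imp_le_nat linorder_not_less order_le_less_trans)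
    then have "hcomp (\<delta> x) = hcomp \<zero>" by (auto simp: hcomp_zero)
    then have "\<delta> x = \<zero>" using hcomp_inj[of "\<delta> x" \<zero>] cl[OF \<delta>(1) x(1)] by simp
    then show False using x(2) by contradiction
  qed
  obtain m where m: "P m" "\<And>k. P k \<Longrightarrow> k \<le> m"
    using P0 bound by (metis GreatestI_nat Greatest_le_nat)
  then obtain \<delta>' where \<delta>': "locally_nilpotent_derivation ver \<delta>'" "\<delta>' F = \<zero>"
    "\<And>z. z \<in> supported_degrees d \<Longrightarrow> \<delta> z = F [^] m \<otimes> \<delta>' z" by (auto simp: P_def)
  have "\<exists>z\<in>supported_degrees d. \<forall>y\<in>supported_degrees d. \<delta>' z \<noteq> F \<otimes> y"
  proof (rule ccontr)
    assume "\<not> ?thesis"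
    then obtain \<epsilon> where \<epsilon>: "\<And>z. z \<in> supported_degrees d \<Longrightarrow> \<epsilon> z \<in> supported_degrees d \<and> \<delta>' z = F \<otimes> \<epsilon> z"
      by metis
    have lnd: "locally_nilpotent_derivation ver \<epsilon>"
      by (rule V.lnd_divide[OF \<delta>'(1), of F]) (use F Fs \<delta>'(2) \<epsilon> in auto)
    have "F \<otimes> \<epsilon> F = F \<otimes> \<zero>" using conjunct2[OF \<epsilon>[OF Fs]] \<delta>'(2) F_closed by (metis r_null)
    then have "\<epsilon> F = \<zero>"
      using F F_closed cl[OF lnd Fs] m_lcancel zero_closed by blast
    moreover have "\<delta> z = F [^] Suc m \<otimes> \<epsilon> z" if z: "z \<in> supported_degrees d" for z
      using \<delta>'(3)[OF z] \<epsilon>[OF z] F_closed cl[OF lnd z] by (simp add: m_assoc)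
    ultimately have "P (Suc m)" using lnd by (auto simp: P_def)
    then show False using m(2)[of "Suc m"] by simp
  qed
  then show thesis using \<delta>' that by blast
qed

text \<open>Homogeneous classes lift to homogeneous elements of the same degree. Together with
  \<open>PIdl_F_supported\<close> this identifies (B/FB)^(d) with B^(d) / F B^(d).\<close>

lemma carrier_veronese_quotient:
  "carrier (veronese (R Quot (PIdl F)) (quotient_grading R gr (PIdl F)) d)
    = (\<lambda>x. PIdl F +> x) ` supported_degrees d"
proof -
  let ?J = "PIdl F"
  interpret J: ideal ?J R by (rule cgenideal_ideal[OF F_closed])
  interpret h: ring_hom_ring R "R Quot ?J" "(+>) ?J" by (rule J.rcos_ring_hom_ring)
  show ?thesis
  proof (intro equalityI subsetI)
    fix v assume "v \<in> carrier (veronese (R Quot ?J) (quotient_grading R gr ?J) d)"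
    then obtain f I where I: "finite I" "I \<subseteq> {n. d dvd n}" "\<And>n. n \<in> I \<Longrightarrow> f n \<in> quotient_grading R gr ?J n"
      and v: "v = (\<Oplus>\<^bsub>R Quot ?J\<^esub>n\<in>I. f n)"
      by (auto simp: veronese_def graded_part_def)
    then have "\<forall>n\<in>I. \<exists>a\<in>gr n. f n = ?J +> a" unfolding quotient_grading_def by blast
    then obtain g where g: "\<And>n. n \<in> I \<Longrightarrow> g n \<in> gr n" "\<And>n. n \<in> I \<Longrightarrow> f n = ?J +> g n" by metis
    have gc: "g \<in> I \<rightarrow> carrier R" using g gr_carrier by blast
    have "?J +> g n \<in> carrier (R Quot ?J)" if "n \<in> I" for n
      using gc that by (intro h.hom_closed) auto
    then have "v = (\<Oplus>\<^bsub>R Quot ?J\<^esub>n\<in>I. ?J +> g n)"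
      unfolding v using g by (intro h.S.finsum_cong') auto
    then have "v = ?J +> (\<Oplus>n\<in>I. g n)"
      using h.hom_finsum[OF gc] by (simp add: comp_def)
    moreover have "(\<Oplus>n\<in>I. g n) \<in> supported_degrees d"
    proof -
      have "g n \<in> supported_degrees d" if n: "n \<in> I" for n
      proof -
        obtain m where "n = m * d" using n I(2) by (metis dvd_def mem_Collect_eq mult.commute subsetD)
        then show ?thesis using g(1)[OF n] homogeneous_supported by blast
      qed
      with I(1) show ?thesis
      proof (induction I rule: finite_induct)
        case (insert n I)
        then have "g n \<in> carrier R" "g \<in> I \<rightarrow> carrier R" by (auto intro: supported_degrees_carrier)
        with insert show ?case
          using subringE(7)[OF supported_degrees_subring] by simp
      qed (use homogeneous_supported[OF gr_zero] in auto)
    qed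
    ultimately show "v \<in> (\<lambda>x. ?J +> x) ` supported_degrees d" by blast
  next
    fix v assume "v \<in> (\<lambda>x. ?J +> x) ` supported_degrees d"
    then obtain x where x: "x \<in> supported_degrees d" "v = ?J +> x" by blast
    have xc: "x \<in> carrier R" using x(1) by (rule supported_degrees_carrier)
    let ?I = "{n. hcomp x n \<noteq> \<zero>}"
    have "v = (\<Oplus>\<^bsub>R Quot ?J\<^esub>n\<in>?I. ?J +> hcomp x n)"
      using h.hom_finsum[of "hcomp x" ?I] hcomp_sum[OF xc] hcomp_carrier[OF xc]
      by (simp add: x(2) comp_def)
    moreover have "?I \<subseteq> {n. d dvd n}" using x(1) by (auto simp: supported_degrees_def)
    moreover have "\<forall>n\<in>?I. ?J +> hcomp x n \<in> quotient_grading R gr ?J n"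
      using hcomp_gr[OF xc] by (auto simp: quotient_grading_def)
    ultimately show "v \<in> carrier (veronese (R Quot ?J) (quotient_grading R gr ?J) d)"
      using finite_hcomp[OF xc] by (auto simp: veronese_def graded_part_def)
  qed
qed

text \<open>If x = F y, then the component of x in degree d + n is F y_n, which is nonzero when y_n
  is. So the degrees occurring in y are those of x lowered by d.\<close>

lemma PIdl_F_supported:
  assumes "x \<in> supported_degrees d" "x \<in> PIdl F"
  obtains y where "y \<in> supported_degrees d" "x = F \<otimes> y"
proof -
  obtain y where y: "y \<in> carrier R" "x = F \<otimes> y"
    using assms(2) F_closed by (auto simp: cgenideal_def m_comm)
  have div: "d dvd n" if "hcomp y n \<noteq> \<zero>" for n
  proof -
    have "hcomp x (d + n) = F \<otimes> hcomp y n"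
      using hcomp_mult_homogeneous[OF F(1) y(1), of "d + n"] y(2) by simp
    also have "\<dots> \<noteq> \<zero>" using F F_closed that hcomp_carrier[OF y(1)] by (simp add: integral_iff)
    finally have "d dvd d + n" using assms(1) by (auto simp: supported_degrees_def)
    then show ?thesis by simp
  qed
  show thesis by (rule that[OF _ y(2)]) (use div y(1) in \<open>auto simp: supported_degrees_def\<close>)
qed

lemma not_rigid_veronese_quotient:
  assumes D: "locally_nilpotent_derivation A D"
    and nz: "y \<in> carrier A" "D y \<noteq> \<zero>\<^bsub>A\<^esub>"
    and G: "finite G" "G \<subseteq> carrier R" and gen: "carrier R = generate_ring R (K \<union> G)"
    and K: "K \<subseteq> gr 0" "\<And>c. c \<in> K \<Longrightarrow> D (\<phi> 0 c) = \<zero>\<^bsub>A\<^esub>"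
  shows "\<not> rigid (veronese (R Quot (PIdl F)) (quotient_grading R gr (PIdl F)) d)"
proof -
  let ?J = "PIdl F" let ?V = "veronese (R Quot ?J) (quotient_grading R gr ?J) d"
  interpret J: ideal ?J R by (rule cgenideal_ideal[OF F_closed])
  interpret h: ring_hom_ring R "R Quot ?J" "(+>) ?J" by (rule J.rcos_ring_hom_ring)
  interpret V: domain ver by (rule ver_domain)
  obtain e where "\<And>n a. a \<in> gr (n * d) \<Longrightarrow> shifts D e n a"
    using ex_shifts_all[OF lnd_derivation[OF D] G gen K] by blast
  then obtain \<delta>0 x where "locally_nilpotent_derivation ver \<delta>0" "\<delta>0 F = \<zero>"
      "x \<in> supported_degrees d" "\<delta>0 x \<noteq> \<zero>"
    using ex_lnd_ver[OF D _ nz] by blast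
  then obtain \<delta> z where \<delta>: "locally_nilpotent_derivation ver \<delta>" "\<delta> F = \<zero>"
    and z: "z \<in> supported_degrees d" "\<And>y. y \<in> supported_degrees d \<Longrightarrow> \<delta> z \<noteq> F \<otimes> y"
    using ex_lnd_ver_nonzero_mod by blast
  note \<delta>' = derivationD[OF lnd_derivation[OF \<delta>(1)], simplified]
  note sub = subringE[OF supported_degrees_subring]
  have Fs: "F \<in> supported_degrees d" using homogeneous_supported[of F 1 d] F by simp
  \<comment> \<open>Two representatives differ by some F w with w in the Veronese subring, and
    \<open>\<delta>\<close> (F w) = F \<open>\<delta>\<close> w because
    \<open>\<delta> F = \<zero>\<close>.\<close>
  have stable: "?J +> \<delta> x = ?J +> \<delta> y"
    if xy: "x \<in> supported_degrees d" "y \<in> supported_degrees d" "?J +> x = ?J +> y" for x y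
  proof -
    have c: "x \<in> carrier R" "y \<in> carrier R" using xy by (auto intro: supported_degrees_carrier)
    have "x \<ominus> y \<in> ?J" using quotient_eq_iff_same_a_r_cos[OF J.is_ideal c] xy(3) by simp
    moreover have "x \<ominus> y \<in> supported_degrees d" unfolding a_minus_def by (intro sub(5,7) xy)
    ultimately obtain w where w: "w \<in> supported_degrees d" "x \<ominus> y = F \<otimes> w"
      using PIdl_F_supported by blast
    have wc: "w \<in> carrier R" "\<delta> w \<in> carrier R" "\<delta> y \<in> carrier R"
      using \<delta>' w xy by (auto intro: supported_degrees_carrier)
    have "x = (x \<ominus> y) \<oplus> y" using c by (simp add: a_minus_def a_assoc l_neg)
    then have "x = F \<otimes> w \<oplus> y" by (simp only: w(2))
    then have "\<delta> x = F \<otimes> \<delta> w \<oplus> \<delta> y"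
      using \<delta>'(2)[of "F \<otimes> w" y] \<delta>'(3)[OF Fs w(1)] xy sub(6)[OF Fs w(1)] \<delta>(2) F_closed wc by simp
    then have "\<delta> x \<ominus> \<delta> y = \<delta> w \<otimes> F"
      using F_closed wc by (simp add: a_minus_def a_assoc r_neg m_comm)
    then have "\<delta> x \<ominus> \<delta> y \<in> ?J" unfolding cgenideal_def using wc(2) by blast
    then show ?thesis
      using quotient_eq_iff_same_a_r_cos[OF J.is_ideal] \<delta>'(1) xy supported_degrees_carrier by metis
  qed
  \<comment> \<open>A representative is chosen inside the Veronese subring, as
    \<open>\<delta>\<close> is controlled only there; \<open>stable\<close> removes the dependence
    on the choice.\<close>
  define \<Delta> where "\<Delta> v = ?J +> \<delta> (SOME x. x \<in> supported_degrees d \<and> ?J +> x = v)" for v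
  have \<Delta>: "\<Delta> (?J +> x) = ?J +> \<delta> x" if x: "x \<in> supported_degrees d" for x
  proof -
    have "\<exists>y. y \<in> supported_degrees d \<and> ?J +> y = ?J +> x" using x by blast
    from someI_ex[OF this] show ?thesis unfolding \<Delta>_def using stable x by blast
  qed
  have zero: "?J +> \<zero> = \<zero>\<^bsub>?V\<^esub>"
    by (simp add: veronese_def)
  have "locally_nilpotent_derivation ?V \<Delta>"
  proof (rule lnd_image[of "(+>) ?J" ver, OF _ _ _ _ \<delta>(1)])
    show "(+>) ?J \<in> ring_hom ver ?V"
      using carrier_veronese_quotient
      by (intro ring_hom_memI) (auto simp: veronese_def supported_degrees_carrier)
    show "(+>) ?J ` carrier ver = carrier ?V" by (simp add: carrier_veronese_quotient)
  qed (use zero V.zero_closed V.a_closed V.m_closed \<Delta> in auto)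
  moreover have "?J +> z \<in> carrier ?V" using z(1) by (simp add: carrier_veronese_quotient)
  moreover have "\<Delta> (?J +> z) \<noteq> \<zero>\<^bsub>?V\<^esub>"
  proof
    assume "\<Delta> (?J +> z) = \<zero>\<^bsub>?V\<^esub>"
    then have "?J +> \<delta> z = ?J +> \<zero>" using \<Delta>[OF z(1)] zero by simp
    moreover have \<delta>z: "\<delta> z \<in> supported_degrees d" using \<delta>'(1) z(1) .
    ultimately have "\<delta> z \<ominus> \<zero> \<in> ?J"
      using quotient_eq_iff_same_a_r_cos[OF J.is_ideal] supported_degrees_carrier zero_closed by metis
    then have "\<delta> z \<in> ?J" using supported_degrees_carrier[OF \<delta>z] by (simp add: a_minus_def)
    \<comment> \<open>Membership in FB would mean divisibility by F within the Veronese subring,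
      which the choice of z excludes.\<close>
    then show False using PIdl_F_supported[OF \<delta>z] z(2) by metis
  qed
  ultimately show ?thesis by (auto simp: rigid_def)
qed

end

section \<open>Regular functions on the complement of a hypersurface\<close>

text \<open>An ideal maximal among those containing J and avoiding the powers of f is prime; Zorn
  provides one, since unions of nonempty chains again avoid them.\<close>

lemma (in cring) ex_prime_avoiding_powers:
  assumes J: "ideal J R" and f: "f \<in> carrier R" "\<And>n::nat. f [^] n \<notin> J"
  obtains P where "primeideal P R" "J \<subseteq> P" "f \<notin> P"
proof -
  define \<A> where "\<A> = {I. ideal I R \<and> J \<subseteq> I \<and> (\<forall>n::nat. f [^] n \<notin> I)}"
  have "\<exists>P\<in>\<A>. \<forall>I\<in>\<A>. P \<subseteq> I \<longrightarrow> I = P"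
  proof (rule subset_Zorn_nonempty)
    show "\<A> \<noteq> {}" using assms by (auto simp: \<A>_def)
    fix C assume C: "C \<noteq> {}" "subset.chain \<A> C"
    then have sub: "C \<subseteq> \<A>" by (auto simp: subset.chain_def)
    have "subset.chain {I. ideal I R} C"
      using C(2) by (auto simp: subset.chain_def \<A>_def)
    then have "ideal (\<Union>C) R" using chain_Union_is_ideal[of C] C(1) by simp
    then show "\<Union>C \<in> \<A>" using sub C(1) by (auto simp: \<A>_def)
  qed
  then obtain P where P: "P \<in> \<A>" and max: "\<And>I. I \<in> \<A> \<Longrightarrow> P \<subseteq> I \<Longrightarrow> I = P" by blast
  interpret P: ideal P R using P by (simp add: \<A>_def)
  have fP: "f [^] n \<notin> P" for n :: nat using P by (simp add: \<A>_def)
  \<comment> \<open>The ideal of all x with a x in P contains P and also b, so by maximality it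
    contains a power of f. Applied twice, this would put a power of f into P.\<close>
  have colon: "\<exists>n::nat. a \<otimes> f [^] n \<in> P" if ab: "a \<in> carrier R" "b \<in> carrier R" "a \<otimes> b \<in> P" "b \<notin> P" for a b
  proof (rule ccontr)
    assume no: "\<not> ?thesis"
    let ?I = "{x \<in> carrier R. a \<otimes> x \<in> P}"
    have "P \<subseteq> ?I" using ab(1) P.Icarr P.I_l_closed by auto
    moreover have "ideal ?I R" by (rule P.helper_max_prime[OF cring_axioms ab(1)])
    ultimately have "?I \<in> \<A>" using no P by (auto simp: \<A>_def)
    then have "?I = P" using max \<open>P \<subseteq> ?I\<close> by blast
    then show False using ab by blast
  qed
  have "primeideal P R"
  proof (rule primeidealI[OF P.is_ideal cring_axioms])
    show "carrier R \<noteq> P" using fP[of 0] by auto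
    fix a b assume ab: "a \<in> carrier R" "b \<in> carrier R" "a \<otimes> b \<in> P"
    show "a \<in> P \<or> b \<in> P"
    proof (rule ccontr)
      assume "\<not> ?thesis"
      then obtain n :: nat where "a \<otimes> f [^] n \<in> P" "a \<notin> P" using colon[OF ab] by blast
      then obtain m :: nat where "f [^] n \<otimes> f [^] m \<in> P"
        using colon[of "f [^] n" a] ab f(1) by (auto simp: m_comm)
      then show False using fP[of "n + m"] f(1) by (simp add: nat_pow_mult)
    qed
  qed
  then show thesis using that[of P] P fP[of 1] f(1) by (simp add: \<A>_def)
qed

lemma (in ideal) finsum_in_ideal: "(\<And>i. i \<in> K \<Longrightarrow> f i \<in> I) \<Longrightarrow> (\<Oplus>i\<in>K. f i) \<in> I"
proof (induction K rule: infinite_finite_induct)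
  case (insert i K)
  moreover have "f i \<in> carrier R" "f \<in> K \<rightarrow> carrier R" using insert.prems Icarr by auto
  ultimately show ?case by simp
qed auto

context graded_cring
begin

lemma homogeneous_idealI:
  assumes I: "ideal I R" and comp: "\<And>x n. x \<in> I \<Longrightarrow> hcomp x n \<in> I"
  shows "homogeneous_ideal R gr I"
proof -
  interpret I: ideal I R by fact
  let ?H = "I \<inter> (\<Union>n. gr n)"
  have Hc: "?H \<subseteq> carrier R" using I.Icarr by blast
  interpret J: ideal "Idl ?H" R by (rule genideal_ideal[OF Hc])
  have "I \<subseteq> Idl ?H"
  proof
    fix x assume x: "x \<in> I"
    have "hcomp x n \<in> Idl ?H" for n
      using genideal_self[OF Hc] comp[OF x] hcomp_gr[OF I.Icarr[OF x]] by blast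
    then show "x \<in> Idl ?H"
      using J.finsum_in_ideal[of "{n. hcomp x n \<noteq> \<zero>}" "hcomp x"] hcomp_sum[OF I.Icarr[OF x]] by simp
  qed
  moreover have "Idl ?H \<subseteq> I" by (rule genideal_minimal[OF I]) auto
  ultimately show ?thesis using I by (auto simp: homogeneous_ideal_def)
qed

lemma homogeneous_ideal_PIdl:
  assumes "f \<in> gr m" shows "homogeneous_ideal R gr (PIdl f)"
proof (rule homogeneous_idealI)
  have fc: "f \<in> carrier R" using assms gr_carrier by blast
  show "ideal (PIdl f) R" by (rule cgenideal_ideal[OF fc])
  fix x n assume "x \<in> PIdl f"
  then obtain y where y: "y \<in> carrier R" "x = f \<otimes> y"
    using fc by (auto simp: cgenideal_def m_comm)
  then have "hcomp x n = (if m \<le> n then hcomp y (n - m) else \<zero>) \<otimes> f"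
    using fc by (simp add: hcomp_mult_homogeneous[OF assms] hcomp_carrier m_comm)
  then show "hcomp x n \<in> PIdl f" using y(1) hcomp_carrier by (auto simp: cgenideal_def)
qed

text \<open>The largest homogeneous ideal inside a prime ideal is prime: look at the product of the
  components of largest degree outside the prime.\<close>

lemma primeideal_homogeneous_core:
  assumes "primeideal P R"
  defines "Q \<equiv> {x \<in> carrier R. \<forall>n. hcomp x n \<in> P}"
  shows "primeideal Q R" and "homogeneous_ideal R gr Q"
proof -
  interpret P: primeideal P R by fact
  have Q: "ideal Q R"
  proof (rule idealI[OF ring_axioms])
    show "subgroup Q (add_monoid R)"
      by (rule subgroup.intro)
        (auto simp: Q_def hcomp_add hcomp_zero hcomp_minus a_inv_def[symmetric])
    fix a x assume ax: "a \<in> Q" "x \<in> carrier R"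
    then have a: "a \<in> carrier R" by (simp add: Q_def)
    have "hcomp (x \<otimes> a) n \<in> P" for n
      unfolding hcomp_mult[OF ax(2) a] using ax
      by (intro P.finsum_in_ideal P.I_l_closed) (auto simp: Q_def hcomp_carrier)
    then show "x \<otimes> a \<in> Q" "a \<otimes> x \<in> Q" using ax a by (simp_all add: Q_def m_comm[of a x])
  qed
  show "homogeneous_ideal R gr Q"
  proof (rule homogeneous_idealI[OF Q])
    fix x n assume "x \<in> Q"
    then show "hcomp x n \<in> Q"
      by (auto simp: Q_def hcomp_carrier hcomp_homogeneous[OF hcomp_gr])
  qed
  show "primeideal Q R"
  proof (rule primeidealI[OF Q cring_axioms])
    have "\<one> \<notin> P" using P.one_imp_carrier P.I_notcarr by blast
    then have "\<one> \<notin> Q" using hcomp_homogeneous[OF one_gr] by (auto simp: Q_def)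
    then show "carrier R \<noteq> Q" by auto
    fix a b assume ab: "a \<in> carrier R" "b \<in> carrier R" "a \<otimes> b \<in> Q"
    have ex: "\<exists>i. hcomp x i \<notin> P \<and> (\<forall>l>i. hcomp x l \<in> P)" if x: "x \<in> carrier R" "x \<notin> Q" for x
    proof -
      have sub: "{n. hcomp x n \<notin> P} \<subseteq> {n. hcomp x n \<noteq> \<zero>}" by auto
      have fin: "finite {n. hcomp x n \<notin> P}" by (rule finite_subset[OF sub finite_hcomp[OF x(1)]])
      moreover have "{n. hcomp x n \<notin> P} \<noteq> {}" using x by (auto simp: Q_def)
      ultimately have "Max {n. hcomp x n \<notin> P} \<in> {n. hcomp x n \<notin> P}" by (rule Max_in)
      moreover have "hcomp x l \<in> P" if "l > Max {n. hcomp x n \<notin> P}" for l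
        using Max_ge[OF fin, of l] that by (meson mem_Collect_eq not_le)
      ultimately show ?thesis by blast
    qed
    show "a \<in> Q \<or> b \<in> Q"
    proof (rule ccontr)
      assume "\<not> ?thesis"
      then have "a \<notin> Q" "b \<notin> Q" by auto
      from ex[OF ab(1) this(1)] ex[OF ab(2) this(2)]
      obtain i j where i: "hcomp a i \<notin> P" "\<forall>l>i. hcomp a l \<in> P"
        and j: "hcomp b j \<notin> P" "\<forall>l>j. hcomp b l \<in> P" by auto
      let ?t = "\<lambda>l. hcomp a l \<otimes> hcomp b (i + j - l)"
      have t: "?t l \<in> carrier R" for l using ab by (simp add: hcomp_carrier)
      \<comment> \<open>In degree i + j, every term other than l = i has a factor beyond i in a or
        beyond j in b.\<close>
      have rest: "(\<Oplus>l\<in>{..i + j} - {i}. ?t l) \<in> P"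
      proof (rule P.finsum_in_ideal)
        fix l assume l: "l \<in> {..i + j} - {i}"
        show "?t l \<in> P"
        proof (cases "l > i")
          case True
          then show ?thesis using i(2) ab by (intro P.I_r_closed) (auto simp: hcomp_carrier)
        next
          case False
          then have "i + j - l > j" using l by auto
          then show ?thesis using j(2) ab by (intro P.I_l_closed) (auto simp: hcomp_carrier)
        qed
      qed
      have "{..i + j} = insert i ({..i + j} - {i})" by auto
      then have "hcomp (a \<otimes> b) (i + j) = (\<Oplus>l\<in>insert i ({..i + j} - {i}). ?t l)"
        using hcomp_mult[OF ab(1,2), of "i + j"] by simp
      also have "\<dots> = ?t i \<oplus> (\<Oplus>l\<in>{..i + j} - {i}. ?t l)"
        using t[of i] t by (intro finsum_insert) auto
      finally have "?t i \<oplus> (\<Oplus>l\<in>{..i + j} - {i}. ?t l) \<in> P"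
        using ab(3) by (metis (no_types, lifting) Q_def mem_Collect_eq)
      then have "(?t i \<oplus> (\<Oplus>l\<in>{..i + j} - {i}. ?t l)) \<ominus> (\<Oplus>l\<in>{..i + j} - {i}. ?t l) \<in> P"
        using rest P.a_closed P.a_inv_closed unfolding a_minus_def by blast
      then have "hcomp a i \<otimes> hcomp b j \<in> P"
        using t[of i] P.Icarr[OF rest] by (simp add: a_minus_def a_assoc r_neg)
      then show False using P.I_prime i(1) j(1) ab hcomp_carrier by blast
    qed
  qed
qed

end

text \<open>Turns independence of representatives into a value for the unions that define the
  operations of \<open>localization\<close>; the given pairs show that these unions are not over
  empty sets.\<close>

lemma UN_pairs_const:
  assumes "(a, s) \<in> Z" "(b, t) \<in> W"
    and "\<And>a s b t. (a, s) \<in> Z \<Longrightarrow> (b, t) \<in> W \<Longrightarrow> f a s b t = X"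
  shows "(\<Union>(a, s)\<in>Z. \<Union>(b, t)\<in>W. f a s b t) = X"
proof -
  have "(\<Union>p\<in>Z. \<Union>q\<in>W. case p of (a, s) \<Rightarrow> case q of (b, t) \<Rightarrow> f a s b t) = (\<Union>p\<in>Z. \<Union>q\<in>W. X)"
    using assms(3) by (intro SUP_cong refl) auto
  moreover have "(\<Union>p\<in>Z. \<Union>q\<in>W. X) = X" using assms(1,2) by auto
  ultimately show ?thesis by (simp add: case_prod_unfold)
qed

section \<open>Fractions over a multiplicative subset of a domain\<close>

context "domain"
begin

context
  fixes S
  assumes S: "S \<subseteq> carrier R" "\<zero> \<notin> S" "\<one> \<in> S" "\<And>s t. s \<in> S \<Longrightarrow> t \<in> S \<Longrightarrow> s \<otimes> t \<in> S"
begin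

text \<open>In a domain the auxiliary factor u is nonzero and cancels, so equality of fractions is
  plain cross multiplication.\<close>

lemma local_frac_iff:
  assumes "a \<in> carrier R" "s \<in> S"
  shows "(b, t) \<in> local_frac R S a s \<longleftrightarrow> b \<in> carrier R \<and> t \<in> S \<and> a \<otimes> t = b \<otimes> s"
proof -
  have "u \<otimes> x = u \<otimes> y \<longleftrightarrow> x = y" if "u \<in> S" "x \<in> carrier R" "y \<in> carrier R" for u x y
    using that S m_lcancel[of u x y] by blast
  then show ?thesis using assms S by (auto simp: local_frac_def subset_iff)
qed

lemma local_frac_eq:
  assumes "a \<in> carrier R" "s \<in> S" "b \<in> carrier R" "t \<in> S"
  shows "local_frac R S a s = local_frac R S b t \<longleftrightarrow> a \<otimes> t = b \<otimes> s"
proof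
  assume "local_frac R S a s = local_frac R S b t"
  moreover have "(a, s) \<in> local_frac R S a s" using assms by (simp add: local_frac_iff)
  ultimately show "a \<otimes> t = b \<otimes> s" using assms by (simp add: local_frac_iff)
next
  assume eq: "a \<otimes> t = b \<otimes> s"
  have c: "s \<in> carrier R" "t \<in> carrier R" "s \<noteq> \<zero>" "t \<noteq> \<zero>" using assms S by auto
  have "a \<otimes> r = x \<otimes> s \<longleftrightarrow> b \<otimes> r = x \<otimes> t" if "x \<in> carrier R" "r \<in> S" for x r
  proof -
    have r: "r \<in> carrier R" using that S by auto
    have "a \<otimes> r = x \<otimes> s \<longleftrightarrow> t \<otimes> (a \<otimes> r) = t \<otimes> (x \<otimes> s)"
      using m_lcancel[of t] c assms that r by simp
    also have "t \<otimes> (a \<otimes> r) = s \<otimes> (b \<otimes> r)"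
      using eq assms c r by (metis m_assoc m_comm)
    also have "t \<otimes> (x \<otimes> s) = s \<otimes> (x \<otimes> t)" using c that by (simp add: m_ac)
    also have "s \<otimes> (b \<otimes> r) = s \<otimes> (x \<otimes> t) \<longleftrightarrow> b \<otimes> r = x \<otimes> t"
      using m_lcancel[of s] c assms that r by simp
    finally show ?thesis .
  qed
  then show "local_frac R S a s = local_frac R S b t"
    using assms by (auto simp: local_frac_iff)
qed

lemma localization_mult:
  assumes "a \<in> carrier R" "s \<in> S" "b \<in> carrier R" "t \<in> S"
  shows "local_frac R S a s \<otimes>\<^bsub>localization R S\<^esub> local_frac R S b t = local_frac R S (a \<otimes> b) (s \<otimes> t)"
proof -
  have "local_frac R S (a' \<otimes> b') (s' \<otimes> t') = local_frac R S (a \<otimes> b) (s \<otimes> t)"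
    if "(a', s') \<in> local_frac R S a s" "(b', t') \<in> local_frac R S b t" for a' s' b' t'
  proof -
    have c: "a' \<in> carrier R" "s' \<in> S" "a \<otimes> s' = a' \<otimes> s" "b' \<in> carrier R" "t' \<in> S" "b \<otimes> t' = b' \<otimes> t"
      using that assms by (auto simp: local_frac_iff)
    then have d: "s' \<in> carrier R" "t' \<in> carrier R" "s \<in> carrier R" "t \<in> carrier R" using assms S by auto
    have "(a' \<otimes> b') \<otimes> (s \<otimes> t) = (a' \<otimes> s) \<otimes> (b' \<otimes> t)" using c(1,4) d assms(1,3) by (simp add: m_ac)
    also have "\<dots> = (a \<otimes> s') \<otimes> (b \<otimes> t')" by (simp only: c(3,6))
    also have "\<dots> = (a \<otimes> b) \<otimes> (s' \<otimes> t')" using d assms(1,3) by (simp add: m_ac)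
    finally show ?thesis using c assms S by (simp add: local_frac_eq)
  qed
  note eq = this
  have "(a, s) \<in> local_frac R S a s" "(b, t) \<in> local_frac R S b t"
    using assms by (simp_all add: local_frac_iff)
  from UN_pairs_const[OF this eq] show ?thesis by (simp add: localization_def)
qed

lemma localization_add:
  assumes "a \<in> carrier R" "s \<in> S" "b \<in> carrier R" "t \<in> S"
  shows "local_frac R S a s \<oplus>\<^bsub>localization R S\<^esub> local_frac R S b t
    = local_frac R S ((a \<otimes> t) \<oplus> (b \<otimes> s)) (s \<otimes> t)"
proof -
  have "local_frac R S ((a' \<otimes> t') \<oplus> (b' \<otimes> s')) (s' \<otimes> t') = local_frac R S ((a \<otimes> t) \<oplus> (b \<otimes> s)) (s \<otimes> t)"
    if "(a', s') \<in> local_frac R S a s" "(b', t') \<in> local_frac R S b t" for a' s' b' t'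
  proof -
    have c: "a' \<in> carrier R" "s' \<in> S" "a \<otimes> s' = a' \<otimes> s" "b' \<in> carrier R" "t' \<in> S" "b \<otimes> t' = b' \<otimes> t"
      using that assms by (auto simp: local_frac_iff)
    then have d: "s' \<in> carrier R" "t' \<in> carrier R" "s \<in> carrier R" "t \<in> carrier R" using assms S by auto
    have "((a' \<otimes> t') \<oplus> (b' \<otimes> s')) \<otimes> (s \<otimes> t)
        = (a' \<otimes> s) \<otimes> (t' \<otimes> t) \<oplus> (b' \<otimes> t) \<otimes> (s' \<otimes> s)"
      using c(1,4) d assms(1,3) by (simp add: l_distr r_distr m_ac)
    also have "\<dots> = (a \<otimes> s') \<otimes> (t' \<otimes> t) \<oplus> (b \<otimes> t') \<otimes> (s' \<otimes> s)" by (simp only: c(3,6))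
    also have "\<dots> = ((a \<otimes> t) \<oplus> (b \<otimes> s)) \<otimes> (s' \<otimes> t')" using d assms(1,3) by (simp add: l_distr r_distr m_ac)
    finally show ?thesis using c d assms S by (simp add: local_frac_eq)
  qed
  note eq = this
  have "(a, s) \<in> local_frac R S a s" "(b, t) \<in> local_frac R S b t"
    using assms by (simp_all add: local_frac_iff)
  from UN_pairs_const[OF this eq] show ?thesis by (simp add: localization_def)
qed

end
end

section \<open>The affine chart where F does not vanish\<close>

locale affine_chart = graded_cring R gr + domain R
  for R :: "('k, 'a, 'n) module_scheme" (structure) and gr +
  fixes F :: 'a and d :: nat
  assumes F_gr: "F \<in> gr d" and F_nonzero: "F \<noteq> \<zero>" and d_pos: "d > 0"
begin

definition chart :: "'a set set" where
  "chart = Proj R gr - V_plus R gr F"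

definition frac :: "nat \<Rightarrow> 'a \<Rightarrow> 'a set \<Rightarrow> ('a \<times> 'a) set" where
  "frac n a = (\<lambda>p\<in>chart. local_frac R (homogeneous_off gr p) a (F [^] n))"

abbreviation "regular \<equiv> regular_functions R gr chart"

lemma F_carrier: "F \<in> carrier R"
  using F_gr gr_carrier by blast

lemma homogeneous_off_props:
  assumes "primeideal p R"
  shows "homogeneous_off gr p \<subseteq> carrier R" "\<zero> \<notin> homogeneous_off gr p" "\<one> \<in> homogeneous_off gr p"
    "\<And>s t. s \<in> homogeneous_off gr p \<Longrightarrow> t \<in> homogeneous_off gr p \<Longrightarrow> s \<otimes> t \<in> homogeneous_off gr p"
proof -
  interpret p: primeideal p R by fact
  show "homogeneous_off gr p \<subseteq> carrier R" by (auto simp: homogeneous_off_def gr_carrier)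
  show "\<zero> \<notin> homogeneous_off gr p" by (simp add: homogeneous_off_def)
  have "\<one> \<notin> p" using p.one_imp_carrier p.I_notcarr by blast
  then show "\<one> \<in> homogeneous_off gr p" using one_gr by (auto simp: homogeneous_off_def)
  fix s t assume st: "s \<in> homogeneous_off gr p" "t \<in> homogeneous_off gr p"
  then obtain m n where mn: "s \<in> gr m" "t \<in> gr n" "s \<notin> p" "t \<notin> p" by (auto simp: homogeneous_off_def)
  then have "s \<otimes> t \<notin> p" using p.I_prime gr_carrier by blast
  then show "s \<otimes> t \<in> homogeneous_off gr p" using gr_mult[OF mn(1,2)] by (auto simp: homogeneous_off_def)
qed

lemma chart_prime: "p \<in> chart \<Longrightarrow> primeideal p R"
  by (simp add: chart_def Proj_def)

lemma chart_iff: "p \<in> chart \<longleftrightarrow> p \<in> Proj R gr \<and> F \<notin> p"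
  by (auto simp: chart_def V_plus_def)

lemma F_irrelevant: "F \<in> irrelevant_ideal R gr"
proof -
  have "F = (\<Oplus>n\<in>{d}. F)" using F_carrier by simp
  then show ?thesis
    unfolding irrelevant_ideal_def graded_part_def using F_gr d_pos
    by (auto intro!: exI[of _ "\<lambda>_. F"] exI[of _ "{d}"])
qed

lemma chartI: "primeideal p R \<Longrightarrow> homogeneous_ideal R gr p \<Longrightarrow> F \<notin> p \<Longrightarrow> p \<in> chart"
  using F_irrelevant by (auto simp: chart_iff Proj_def)

text \<open>This is the generic point. Fractions are compared there, because cross multiplication
  does not depend on the point.\<close>

lemma zero_in_chart: "{\<zero>} \<in> chart"
  by (intro chartI zeroprimeideal homogeneous_idealI zeroideal)
    (use F_nonzero in \<open>auto simp: hcomp_zero\<close>)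

lemma F_pow_off: "p \<in> chart \<Longrightarrow> F [^] (n::nat) \<in> homogeneous_off gr p"
proof (induction n)
  case 0
  then show ?case using homogeneous_off_props(3)[OF chart_prime] by simp
next
  case (Suc n)
  moreover have "F \<in> homogeneous_off gr p"
    using Suc.prems F_gr by (auto simp: homogeneous_off_def chart_iff)
  ultimately show ?case using homogeneous_off_props(4)[OF chart_prime] by simp
qed

lemma F_pow_gr: "F [^] (n::nat) \<in> gr (n * d)"
  by (rule pow_gr[OF F_gr])

lemma F_pow_carrier: "F [^] (n::nat) \<in> carrier R"
  using F_carrier by simp

lemma
  assumes "p \<in> chart"
    and "a \<in> carrier R" "s \<in> homogeneous_off gr p" "b \<in> carrier R" "t \<in> homogeneous_off gr p"
  shows local_frac_chart_eq:
      "local_frac R (homogeneous_off gr p) a s = local_frac R (homogeneous_off gr p) b t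
        \<longleftrightarrow> a \<otimes> t = b \<otimes> s"
    and localization_chart_mult:
      "local_frac R (homogeneous_off gr p) a s
          \<otimes>\<^bsub>localization R (homogeneous_off gr p)\<^esub> local_frac R (homogeneous_off gr p) b t
        = local_frac R (homogeneous_off gr p) (a \<otimes> b) (s \<otimes> t)"
    and localization_chart_add:
      "local_frac R (homogeneous_off gr p) a s
          \<oplus>\<^bsub>localization R (homogeneous_off gr p)\<^esub> local_frac R (homogeneous_off gr p) b t
        = local_frac R (homogeneous_off gr p) ((a \<otimes> t) \<oplus> (b \<otimes> s)) (s \<otimes> t)"
proof -
  note S = homogeneous_off_props[OF chart_prime[OF assms(1)]]
  show "local_frac R (homogeneous_off gr p) a s = local_frac R (homogeneous_off gr p) b t
      \<longleftrightarrow> a \<otimes> t = b \<otimes> s"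
    by (rule local_frac_eq[OF S assms(2-5)])
  show "local_frac R (homogeneous_off gr p) a s
        \<otimes>\<^bsub>localization R (homogeneous_off gr p)\<^esub> local_frac R (homogeneous_off gr p) b t
      = local_frac R (homogeneous_off gr p) (a \<otimes> b) (s \<otimes> t)"
    by (rule localization_mult[OF S assms(2-5)])
  show "local_frac R (homogeneous_off gr p) a s
        \<oplus>\<^bsub>localization R (homogeneous_off gr p)\<^esub> local_frac R (homogeneous_off gr p) b t
      = local_frac R (homogeneous_off gr p) ((a \<otimes> t) \<oplus> (b \<otimes> s)) (s \<otimes> t)"
    by (rule localization_add[OF S assms(2-5)])
qed

lemma Proj_open_chart: "Proj_open R gr chart"
proof -
  have "chart = {p \<in> Proj R gr. \<not> PIdl F \<subseteq> p}"
  proof -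
    have iff: "PIdl F \<subseteq> p \<longleftrightarrow> F \<in> p" if "p \<in> Proj R gr" for p
      using that cgenideal_minimal[of p F] cgenideal_self[OF F_carrier]
      by (auto simp: Proj_def primeideal_def)
    show ?thesis by (rule Set.set_eqI) (simp add: chart_iff iff cong: conj_cong)
  qed
  then show ?thesis unfolding Proj_open_def using homogeneous_ideal_PIdl[OF F_gr] by blast
qed

lemma frac_closed:
  assumes a: "a \<in> gr (n * d)"
  shows "frac n a \<in> carrier regular"
proof -
  have "local_frac R (homogeneous_off gr p) a (F [^] n) \<in> carrier (homogeneous_localization R gr p)"
    if "p \<in> chart" for p
    using a F_pow_gr[of n] F_pow_off[OF that, of n]
    by (auto simp: homogeneous_localization_def homogeneous_off_def)
  then have "frac n a \<in> (\<Pi>\<^sub>E p\<in>chart. carrier (homogeneous_localization R gr p))"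
    by (auto simp: frac_def)
  moreover have "F [^] n \<notin> q \<and> frac n a q = local_frac R (homogeneous_off gr q) a (F [^] n)" if "q \<in> chart" for q
    using that F_pow_off[OF that, of n] by (simp add: frac_def homogeneous_off_def)
  then have "\<forall>p\<in>chart. \<exists>V. Proj_open R gr V \<and> p \<in> V \<and> V \<subseteq> chart \<and>
      (\<exists>n'. \<exists>a'\<in>gr n'. \<exists>s\<in>gr n'. \<forall>q\<in>V. s \<notin> q \<and> frac n a q = local_frac R (homogeneous_off gr q) a' s)"
    using Proj_open_chart a F_pow_gr[of n] by blast
  ultimately show ?thesis by (simp add: regular_functions_def)
qed

text \<open>A regular function is \<open>a / s\<close> at the generic point. The homogeneous elements \<open>b\<close> for which
  \<open>b a\<close> is divisible by \<open>s\<close> lie in no prime of the chart, so some power of \<open>F\<close> is among them.\<close>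

lemma frac_surj:
  assumes \<sigma>: "\<sigma> \<in> carrier regular"
  shows "\<exists>n. \<exists>a\<in>gr (n * d). \<sigma> = frac n a"
proof -
  let ?L = "\<lambda>p. local_frac R (homogeneous_off gr p)"
  \<comment> \<open>Every nonempty open set contains the generic point, so a local expression for
    \<open>\<sigma>\<close> at p is also valid at \<open>{\<zero>}\<close>.\<close>
  have loc: "\<exists>n a s. a \<in> gr n \<and> s \<in> gr n \<and> s \<notin> p \<and> \<sigma> p = ?L p a s \<and> s \<noteq> \<zero> \<and> \<sigma> {\<zero>} = ?L {\<zero>} a s"
    if p: "p \<in> chart" for p
  proof -
    have "\<exists>V. Proj_open R gr V \<and> p \<in> V \<and> V \<subseteq> chart \<and>
        (\<exists>n. \<exists>a\<in>gr n. \<exists>s\<in>gr n. \<forall>q\<in>V. s \<notin> q \<and> \<sigma> q = ?L q a s)"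
      using \<sigma> p by (simp add: regular_functions_def)
    then obtain V where V: "Proj_open R gr V" "p \<in> V" "V \<subseteq> chart"
      and "\<exists>n. \<exists>a\<in>gr n. \<exists>s\<in>gr n. \<forall>q\<in>V. s \<notin> q \<and> \<sigma> q = ?L q a s"
      by (elim exE[of "\<lambda>V. Proj_open R gr V \<and> _ V"] conjE) (rule that; assumption)
    then obtain n a s where as: "a \<in> gr n" "s \<in> gr n"
      and q: "\<And>q. q \<in> V \<Longrightarrow> s \<notin> q \<and> \<sigma> q = ?L q a s" by blast
    obtain I where I: "homogeneous_ideal R gr I" "V = {p \<in> Proj R gr. \<not> I \<subseteq> p}"
      using V(1) by (auto simp: Proj_open_def)
    have "\<zero> \<in> p" using chart_prime[OF p] by (simp add: primeideal_def additive_subgroup.zero_closed ideal_def)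
    then have "{\<zero>} \<in> V" using V(2) I(2) zero_in_chart by (auto simp: chart_iff)
    from q[OF this] q[OF V(2)] as show ?thesis by blast
  qed
  obtain n0 a s where as: "a \<in> gr n0" "s \<in> gr n0" "s \<noteq> \<zero>" "\<sigma> {\<zero>} = ?L {\<zero>} a s"
    using loc[OF zero_in_chart] by blast
  have asc: "a \<in> carrier R" "s \<in> carrier R" using as gr_carrier by blast+
  have off0: "t \<in> homogeneous_off gr {\<zero>}" if "t \<in> gr m" "t \<noteq> \<zero>" for t m
    using that by (auto simp: homogeneous_off_def)
  define J where "J = {b \<in> carrier R. \<exists>c\<in>carrier R. a \<otimes> b = s \<otimes> c}"
  have J: "ideal J R"
  proof -
    interpret sI: ideal "PIdl s" R by (rule cgenideal_ideal[OF asc(2)])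
    have "PIdl s = {s \<otimes> c | c. c \<in> carrier R}"
      unfolding cgenideal_def by (rule Collect_cong) (metis asc(2) m_comm)
    then have "J = {b \<in> carrier R. a \<otimes> b \<in> PIdl s}"
      unfolding J_def by blast
    then show ?thesis using sI.helper_max_prime[OF cring_axioms asc(1)] by simp
  qed
  \<comment> \<open>a and s are homogeneous of the same degree n0, so a relation a b = s c holds
    component by component.\<close>
  have J_comp: "\<exists>c\<in>gr n. a \<otimes> hcomp b n = s \<otimes> c" if b: "b \<in> J" for b n
  proof -
    obtain c where c: "c \<in> carrier R" "a \<otimes> b = s \<otimes> c" and bc: "b \<in> carrier R"
      using b by (auto simp: J_def)
    have "a \<otimes> hcomp b n = hcomp (a \<otimes> b) (n0 + n)"
      using hcomp_mult_homogeneous[OF as(1) bc, of "n0 + n"] by simp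
    also have "\<dots> = s \<otimes> hcomp c n"
      unfolding c(2) using hcomp_mult_homogeneous[OF as(2) c(1), of "n0 + n"] by simp
    finally show ?thesis using hcomp_gr[OF c(1)] by blast
  qed
  \<comment> \<open>The local denominator t at p is outside p; it lies in J, since a / s = b / t at
    the generic point.\<close>
  have J_not: "\<not> J \<subseteq> p" if p: "p \<in> chart" for p
  proof -
    obtain m b t where t: "b \<in> gr m" "t \<in> gr m" "t \<notin> p" "t \<noteq> \<zero>" "\<sigma> {\<zero>} = ?L {\<zero>} b t"
      using loc[OF p] by blast
    have "a \<otimes> t = b \<otimes> s"
      using local_frac_chart_eq[OF zero_in_chart asc(1) off0[OF as(2,3)]
          gr_carrier[OF t(1)] off0[OF t(2,4)]] as(4) t(5) by metis
    also have "b \<otimes> s = s \<otimes> b" using gr_carrier[OF t(1)] asc(2) by (rule m_comm)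
    finally have "t \<in> J"
      unfolding J_def using gr_carrier[OF t(1)] gr_carrier[OF t(2)] by blast
    then show ?thesis using t(3) by blast
  qed
  have "\<exists>n::nat. F [^] n \<in> J"
  proof (rule ccontr)
    assume "\<not> ?thesis"
    then obtain P where P: "primeideal P R" "J \<subseteq> P" "F \<notin> P"
      using ex_prime_avoiding_powers[OF J F_carrier] by metis
    \<comment> \<open>P need not be homogeneous. Its homogeneous core is a point of the chart and
      still contains J, as J contains the components of its elements.\<close>
    define Q where "Q = {x \<in> carrier R. \<forall>n. hcomp x n \<in> P}"
    have "F \<notin> Q" using P(3) hcomp_homogeneous[OF F_gr] by (auto simp: Q_def)
    then have "Q \<in> chart" using primeideal_homogeneous_core[OF P(1)] chartI by (simp add: Q_def)
    moreover have "J \<subseteq> Q"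
    proof
      fix x assume x: "x \<in> J"
      have xc: "x \<in> carrier R" using x by (simp add: J_def)
      have "hcomp x n \<in> J" for n
        using J_comp[OF x, of n] hcomp_carrier[OF xc] gr_carrier by (auto simp: J_def)
      then show "x \<in> Q" using P(2) xc by (auto simp: Q_def)
    qed
    ultimately show False using J_not by blast
  qed
  then obtain n :: nat where "F [^] n \<in> J" by blast
  \<comment> \<open>\<open>J_comp\<close> is used in degree \<open>n * d\<close>, where F^n is its
    own component; this makes c homogeneous of the degree required of a numerator over F^n.\<close>
  then obtain c where c: "c \<in> gr (n * d)" "a \<otimes> F [^] n = s \<otimes> c"
    using J_comp[of "F [^] n" "n * d"] hcomp_homogeneous[OF F_pow_gr] by auto
  have cc: "c \<in> carrier R" using c gr_carrier by blast
  have "\<sigma> p = frac n c p" if p: "p \<in> chart" for p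
  proof -
    obtain m b t where t: "b \<in> gr m" "t \<in> gr m" "t \<notin> p" "\<sigma> p = ?L p b t" "t \<noteq> \<zero>" "\<sigma> {\<zero>} = ?L {\<zero>} b t"
      using loc[OF p] by blast
    have tc: "b \<in> carrier R" "t \<in> carrier R" using t gr_carrier by blast+
    have eq: "a \<otimes> t = b \<otimes> s"
      using local_frac_chart_eq[OF zero_in_chart asc(1) off0[OF as(2,3)] tc(1) off0[OF t(2,5)]]
        as(4) t(6) by metis
    have "s \<otimes> (b \<otimes> F [^] n) = (a \<otimes> t) \<otimes> F [^] n"
      unfolding eq using tc asc F_pow_carrier by (simp add: m_ac)
    also have "\<dots> = t \<otimes> (a \<otimes> F [^] n)" using tc asc F_pow_carrier by (simp add: m_ac)
    also have "\<dots> = s \<otimes> (c \<otimes> t)" unfolding c(2) using tc asc cc by (simp add: m_ac)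
    finally have "b \<otimes> F [^] n = c \<otimes> t"
      using m_lcancel[of s] as(3) asc tc cc F_pow_carrier by simp
    moreover have "t \<in> homogeneous_off gr p" using t by (auto simp: homogeneous_off_def)
    ultimately show ?thesis
      using local_frac_chart_eq[OF p, of b t c "F [^] n"] F_pow_off[OF p] tc cc p t(4)
      by (simp add: frac_def)
  qed
  moreover have "\<sigma> p = undefined" if "p \<notin> chart" for p
    using \<sigma> that by (auto simp: regular_functions_def PiE_def extensional_def)
  ultimately have "\<sigma> = frac n c" by (intro ext) (auto simp: frac_def)
  then show ?thesis using c(1) by blast
qed

text \<open>The identities hold at each point by cross multiplication, and injectivity is read off
  at the generic point. From here on the regular functions take the place of B_(F).\<close>

sublocale dehomogenization R gr F d regular frac
proof unfold_locales
  show "F \<in> gr d" "F \<noteq> \<zero>" "d > 0" using F_gr F_nonzero d_pos by auto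
  show "frac n a \<in> carrier regular" if "a \<in> gr (n * d)" for a n
    using that by (rule frac_closed)
  show "\<exists>n. \<exists>a\<in>gr (n * d). x = frac n a" if "x \<in> carrier regular" for x
    using that by (rule frac_surj)
  show "frac 0 \<one> = \<one>\<^bsub>regular\<^esub>" "frac 0 \<zero> = \<zero>\<^bsub>regular\<^esub>"
    by (auto simp: frac_def regular_functions_def homogeneous_localization_def localization_def)
  show "frac n (a \<oplus> b) = frac n a \<oplus>\<^bsub>regular\<^esub> frac n b" if "a \<in> gr (n * d)" "b \<in> gr (n * d)" for a b n
  proof
    fix p
    have ab: "a \<in> carrier R" "b \<in> carrier R" using that gr_carrier by blast+
    have "(a \<oplus> b) \<otimes> (F [^] n \<otimes> F [^] n) = (a \<otimes> F [^] n \<oplus> b \<otimes> F [^] n) \<otimes> F [^] n"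
      using ab F_pow_carrier by (simp add: l_distr r_distr m_ac)
    then show "frac n (a \<oplus> b) p = (frac n a \<oplus>\<^bsub>regular\<^esub> frac n b) p"
      using ab F_pow_off[of p n] F_pow_carrier homogeneous_off_props(4)[OF chart_prime, of p]
      by (auto simp: frac_def regular_functions_def homogeneous_localization_def
          localization_chart_add local_frac_chart_eq)
  qed
  show "frac (m + n) (a \<otimes> b) = frac m a \<otimes>\<^bsub>regular\<^esub> frac n b" if "a \<in> gr (m * d)" "b \<in> gr (n * d)" for a b m n
  proof
    fix p
    have ab: "a \<in> carrier R" "b \<in> carrier R" using that gr_carrier by blast+
    show "frac (m + n) (a \<otimes> b) p = (frac m a \<otimes>\<^bsub>regular\<^esub> frac n b) p"
      using ab F_pow_off[of p] F_carrier
      by (auto simp: frac_def regular_functions_def homogeneous_localization_def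
          localization_chart_mult nat_pow_mult)
  qed
  show "frac (Suc n) (F \<otimes> a) = frac n a" if "a \<in> gr (n * d)" for a n
  proof
    fix p
    have a: "a \<in> carrier R" using that gr_carrier by blast
    then have "(F \<otimes> a) \<otimes> F [^] n = a \<otimes> F [^] Suc n"
      using F_carrier by (simp add: m_ac)
    moreover have "F \<otimes> a \<in> carrier R" using a F_carrier by simp
    ultimately show "frac (Suc n) (F \<otimes> a) p = frac n a p"
      using local_frac_chart_eq[of p "F \<otimes> a" "F [^] Suc n" a "F [^] n"] F_pow_off[of p n] F_pow_off[of p "Suc n"] a
      by (simp add: frac_def restrict_def del: nat_pow_Suc)
  qed
  show "a = b" if ab: "a \<in> gr (n * d)" "b \<in> gr (n * d)" "frac n a = frac n b" for a b n
  proof -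
    have c: "a \<in> carrier R" "b \<in> carrier R" using ab gr_carrier by blast+
    have "local_frac R (homogeneous_off gr {\<zero>}) a (F [^] n) = local_frac R (homogeneous_off gr {\<zero>}) b (F [^] n)"
      using fun_cong[OF ab(3), of "{\<zero>}"] zero_in_chart by (simp add: frac_def)
    then have "a \<otimes> F [^] n = b \<otimes> F [^] n"
      using local_frac_chart_eq[OF zero_in_chart] c F_pow_off[OF zero_in_chart] by simp
    moreover have "F [^] n \<noteq> \<zero>"
      using F_pow_off[OF zero_in_chart, of n] by (auto simp: homogeneous_off_def)
    ultimately show ?thesis using m_rcancel[of "F [^] n"] c F_pow_carrier by simp
  qed
qed

end

section \<open>Non-rigidity\<close>

text \<open>A nonzero scalar acts through a unit, and units of an \<nat>-graded domain have degree
  zero. So constants can be dehomogenized by \<open>\<phi> 0\<close>.\<close>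

lemma (in algebra) scalar_gr_0:
  assumes "field R" "domain M" "graded_cring M gr" "c \<in> carrier R"
  shows "c \<odot>\<^bsub>M\<^esub> \<one>\<^bsub>M\<^esub> \<in> gr 0"
proof (cases "c = \<zero>")
  case True
  then show ?thesis using graded_cring.gr_zero[OF assms(3)] by simp
next
  case False
  interpret k: field R by fact
  have c: "inv c \<in> carrier R" "c \<otimes> inv c = \<one>"
    using False assms(4) k.field_Units by auto
  have "(c \<odot>\<^bsub>M\<^esub> \<one>\<^bsub>M\<^esub>) \<otimes>\<^bsub>M\<^esub> (inv c \<odot>\<^bsub>M\<^esub> \<one>\<^bsub>M\<^esub>) = \<one>\<^bsub>M\<^esub>"
    using assms(4) c by (simp add: smult_assoc2 smult_assoc1[symmetric])
  then show ?thesis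
    using assms c by (intro unit_gr_0[of M gr _ "inv c \<odot>\<^bsub>M\<^esub> \<one>\<^bsub>M\<^esub>"]) simp_all
qed

lemma (in algebra) add_pow_eq_zero:
  assumes "field R" "char_zero R" "n > 0" "x \<in> carrier M" "[(n::nat)] \<cdot>\<^bsub>M\<^esub> x = \<zero>\<^bsub>M\<^esub>"
  shows "x = \<zero>\<^bsub>M\<^esub>"
proof -
  interpret k: field R by fact
  let ?c = "[n] \<cdot> \<one>"
  have c: "?c \<in> carrier R" "?c \<noteq> \<zero>" using assms by (auto simp: char_zero_def)
  have "[(m::nat)] \<cdot>\<^bsub>M\<^esub> x = ([m] \<cdot> \<one>) \<odot>\<^bsub>M\<^esub> x" for m
    by (induction m) (simp_all add: assms(4) smult_l_distr)
  then have "?c \<odot>\<^bsub>M\<^esub> x = \<zero>\<^bsub>M\<^esub>" using assms(5) by simp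
  moreover have inv: "inv ?c \<in> carrier R" "inv ?c \<otimes> ?c = \<one>" using c k.field_Units by auto
  ultimately have "(inv ?c \<otimes> ?c) \<odot>\<^bsub>M\<^esub> x = \<zero>\<^bsub>M\<^esub>"
    using smult_assoc1[OF inv(1) c(1) assms(4)] smult_r_null[OF inv(1)] by metis
  then show ?thesis using inv(2) assms(4) by simp
qed

theorem theorem1p6:
  fixes k :: "('k, 'm) ring_scheme"
    and B :: "('k, 'b, 'n) module_scheme"
    and gr :: "nat \<Rightarrow> 'b set"
    and F :: 'b
    and d :: nat
  assumes "field k" and "char_zero k"
    and "finitely_generated_algebra k B" and "normal_domain B"
    and "nat_graded B gr"
    and "height B (irrelevant_ideal B gr) \<ge> 2"
    and "d > 0" and "F \<in> gr d" and "ring_prime\<^bsub>B\<^esub> F"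
    and "has_nontrivial_Ga_action k (regular_functions B gr (Proj B gr - V_plus B gr F))"
  shows "\<not> rigid (veronese (B Quot (PIdl\<^bsub>B\<^esub> F)) (quotient_grading B gr (PIdl\<^bsub>B\<^esub> F)) d)"
proof -
  have dom: "domain B" using \<open>normal_domain B\<close> by (simp add: normal_domain_def)
  interpret algebra k B using assms(3) by (simp add: finitely_generated_algebra_def)
  interpret affine_chart B gr F d
    using assms(5,7-9) dom
    by (intro affine_chart.intro affine_chart_axioms.intro graded_cring.intro graded_cring_axioms.intro)
      (auto simp: ring_prime_def domain_def)
  let ?A = "regular_functions B gr chart"
  note scalar = scalar_gr_0[OF assms(1) dom graded_cring_axioms]
  \<comment> \<open>Identifies the constants of the function ring with the images of those of B, so
    that D killing the former gives the hypothesis on K in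
    \<open>not_rigid_veronese_quotient\<close>.\<close>
  have smult_one: "c \<odot>\<^bsub>?A\<^esub> \<one>\<^bsub>?A\<^esub> = frac 0 (c \<odot>\<^bsub>B\<^esub> \<one>\<^bsub>B\<^esub>)" if c: "c \<in> carrier k" for c
  proof
    fix p
    show "(c \<odot>\<^bsub>?A\<^esub> \<one>\<^bsub>?A\<^esub>) p = frac 0 (c \<odot>\<^bsub>B\<^esub> \<one>\<^bsub>B\<^esub>) p"
      using c F_pow_off[of p 0]
      by (auto simp: frac_def regular_functions_def homogeneous_localization_def localization_chart_mult
        localization_def[of B "homogeneous_off gr p", THEN arg_cong[of _ _ one]])
  qed
  \<comment> \<open>A multiple of b / F^m is the same multiple of b over F^m, so torsion would
    already occur in B, where positive integers are invertible scalars.\<close>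
  have torsion_free: "x = \<zero>\<^bsub>?A\<^esub>" if n: "n > 0" and x: "x \<in> carrier ?A" and zero: "[(n::nat)] \<cdot>\<^bsub>?A\<^esub> x = \<zero>\<^bsub>?A\<^esub>" for n x
  proof -
    obtain m b where b: "b \<in> gr (m * d)" "x = frac m b" using \<phi>_surj[OF x] by blast
    have pow: "[(i::nat)] \<cdot>\<^bsub>B\<^esub> b \<in> gr (m * d) \<and> [i] \<cdot>\<^bsub>?A\<^esub> x = frac m ([i] \<cdot>\<^bsub>B\<^esub> b)" for i
      by (induction i) (auto simp: b gr_zero \<phi>_n_zero gr_add \<phi>_add)
    then have "[n] \<cdot>\<^bsub>B\<^esub> b = \<zero>\<^bsub>B\<^esub>"
      using zero \<phi>_inj[OF _ gr_zero, of "[n] \<cdot>\<^bsub>B\<^esub> b" m] by (simp add: \<phi>_n_zero)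
    then have "b = \<zero>\<^bsub>B\<^esub>" using add_pow_eq_zero[OF assms(1,2) n gr_carrier[OF b(1)]] by simp
    then show ?thesis using b by (simp add: \<phi>_n_zero)
  qed
  obtain \<rho> a0 where \<rho>: "Ga_action k ?A \<rho>" "a0 \<in> carrier ?A" "\<rho> a0 \<noteq> monom (UP ?A) a0 0"
    using assms(10) by (auto simp: has_nontrivial_Ga_action_def chart_def)
  have const: "c \<odot>\<^bsub>?A\<^esub> \<one>\<^bsub>?A\<^esub> \<in> carrier ?A" if "c \<in> carrier k" for c
    using \<phi>_closed[of "c \<odot>\<^bsub>B\<^esub> \<one>\<^bsub>B\<^esub>" 0] scalar[OF that] by (simp add: smult_one[OF that])
  obtain D where D: "locally_nilpotent_derivation ?A D"
      "\<And>c. c \<in> carrier k \<Longrightarrow> D (c \<odot>\<^bsub>?A\<^esub> \<one>\<^bsub>?A\<^esub>) = \<zero>\<^bsub>?A\<^esub>" "\<exists>y\<in>carrier ?A. D y \<noteq> \<zero>\<^bsub>?A\<^esub>"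
    by (rule Ga_action_imp_lnd[OF A_cring \<rho>(1) _ _ \<rho>(2,3)]) (use const torsion_free in auto)
  obtain G where G: "finite G" "G \<subseteq> carrier B"
    "carrier B = generate_ring B ((\<lambda>c. c \<odot>\<^bsub>B\<^esub> \<one>\<^bsub>B\<^esub>) ` carrier k \<union> G)"
    using assms(3) by (auto simp: finitely_generated_algebra_def)
  obtain y where y: "y \<in> carrier ?A" "D y \<noteq> \<zero>\<^bsub>?A\<^esub>" using D(3) by blast
  show ?thesis
    by (rule not_rigid_veronese_quotient[OF D(1) y G]) (use scalar D(2) smult_one in auto)
qed

end
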